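(* Let $A$, $H$ and the double bicrossproduct $D=A\stackrel{b}{\bowtie}H$ be finite-dimensional braided Hopf algebras in the Yetter–Drinfeld category ${}^B_B\mathcal{YD}$. Let $\Lambda^l_A,\Lambda^l_D$ be non-zero left integrals of $A$ and $D$, and $\Lambda^r_H,\Lambda^r_D$ non-zero right integrals of $H$ and $D$. Then: (i) there are $u\in H$ and $v\in A$ such that $$\Lambda_D^l=\Lambda_A^l\otimes u,\qquad \Lambda_D^r=v\otimes\Lambda_H^r;$$ (ii) if $D=A\stackrel{b}{\bowtie}H$ is semisimple, then $A$ and $H$ are semisimple; (iii) if $D=A\stackrel{b}{\bowtie}H$ is unimodular, i.e. $\Lambda_D^l=\Lambda_D^r$ (write $\Lambda_D$ for this element), then there exists a non-zero $x\in k$ such that $\Lambda_D=x\,\Lambda_A^l\otimes\Lambda_H^r$, and $A\stackrel{b}{\bowtie}H$ is semisimple if and only if $A$ and $H$ are semisimple.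
   Context: $k$ is a field, $B$ is a Hopf algebra over $k$ with invertible antipode, and ${}^B_B\mathcal{YD}$ is the braided tensor category of Yetter–Drinfeld modules over $B$, with braiding denoted $C$. Braided Hopf algebras are Hopf algebras in this category. A left (right) integral of a braided Hopf algebra $H$ is an element $\Lambda\in H$ with $h\Lambda=\epsilon(h)\Lambda$ (respectively $\Lambda h=\epsilon(h)\Lambda$) for all $h\in H$; for finite-dimensional braided Hopf algebras in ${}^B_B\mathcal{YD}$ the spaces of left and of right integrals are one-dimensional, and $\Lambda_H^l$, $\Lambda_H^r$ denote a non-zero left and a non-zero right integral. Unimodularity means that the left and right integrals coincide. Double bicrossproduct. Let $A$ and $H$ be braided bialgebras with morphisms $\alpha:H\otimes A\to A$, $\beta:H\otimes A\to H$, $\phi:A\to H\otimes A$, $\psi:H\to H\otimes A$ such that $(A,\alpha)$ is a left $H$-module coalgebra, $(H,\beta)$ is a right $A$-module coalgebra, $(A,\phi)$ is a left $H$-comodule algebra and $(H,\psi)$ is a right $A$-comodule algebra. The double bicrossproduct $D=A\stackrel{b}{\bowtie}H$ (in full, $A^\phi_\alpha\bowtie^\psi_\beta H$) is $A\otimes H$ with $$m_D=(m_A\otimes m_H)(id_A\otimes\alpha\otimes\beta\otimes id_H)(id_A\otimes id_H\otimes C_{H,A}\otimes id_A\otimes id_H)(id_A\otimes\Delta_H\otimes\Delta_A\otimes id_H),$$ $$\Delta_D=(id_A\otimes m_H\otimes m_A\otimes id_H)(id_A\otimes id_H\otimes C_{A,H}\otimes id_A\otimes id_H)(id_A\otimes\phi\otimes\psi\otimes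 id_H)(\Delta_A\otimes\Delta_H),$$ $$\epsilon_D=\epsilon_A\otimes\epsilon_H,\qquad \eta_D=\eta_A\otimes\eta_H.$$ *)

theory Defs
  imports Complex_Main "HOL-Library.Poly_Mapping"
begin

section \<open>Vector spaces and tensor products\<close>

text \<open>
  Every vector space over a field has a basis. A vector space over \<open>'k\<close> with a basis indexed by
  the type \<open>'x\<close> is represented by the type \<open>'x \<Rightarrow>\<^sub>0 'k\<close> of finitely supported coefficient families;
  there is no restriction on \<open>'x\<close>, and linear maps are arbitrary. (The zero space is the only one
  not of this form; it carries no Hopf algebra, since \<open>\<epsilon>(1) = 1\<close>.) The tensor product of the
  spaces with bases \<open>'x\<close> and \<open>'y\<close> is the space with basis \<open>'x \<times> 'y\<close>. The lemmas below state that
  every vector space with a basis is of this form up to isomorphism, and that the tensor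
  product has its universal property.
\<close>

abbreviation coef :: "('x \<Rightarrow>\<^sub>0 'k::zero) \<Rightarrow> 'x \<Rightarrow> 'k" where
  "coef \<equiv> Poly_Mapping.lookup"

abbreviation supp :: "('x \<Rightarrow>\<^sub>0 'k::zero) \<Rightarrow> 'x set" where
  "supp \<equiv> Poly_Mapping.keys"

definition scl :: "'k::field \<Rightarrow> ('x \<Rightarrow>\<^sub>0 'k) \<Rightarrow> ('x \<Rightarrow>\<^sub>0 'k)" where
  "scl c = Poly_Mapping.map ((*) c)"

lemma lookup_scl [simp]: "coef (scl c p) x = c * coef p x"
  by (simp add: scl_def Poly_Mapping.map.rep_eq when_def)

interpretation kvec: vector_space scl
  by unfold_locales (auto intro!: poly_mapping_eqI simp: lookup_add algebra_simps)

abbreviation bvec :: "'x \<Rightarrow> ('x \<Rightarrow>\<^sub>0 'k::field)" where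
  "bvec x \<equiv> Poly_Mapping.single x 1"

text \<open>Linear extension of a map defined on the basis, into a space with scalar multiplication \<open>s\<close>.\<close>

definition lin_ext :: "('k::field \<Rightarrow> 'v \<Rightarrow> 'v::ab_group_add) \<Rightarrow> ('x \<Rightarrow> 'v) \<Rightarrow> ('x \<Rightarrow>\<^sub>0 'k) \<Rightarrow> 'v" where
  "lin_ext s f p = (\<Sum>x\<in>supp p. s (coef p x) (f x))"

definition tensor :: "('x \<Rightarrow>\<^sub>0 'k::field) \<Rightarrow> ('y \<Rightarrow>\<^sub>0 'k) \<Rightarrow> ('x \<times> 'y \<Rightarrow>\<^sub>0 'k)" (infixr "\<otimes>" 75) where
  "p \<otimes> q = (\<Sum>x\<in>supp p. \<Sum>y\<in>supp q. Poly_Mapping.single (x, y) (coef p x * coef q y))"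

text \<open>The linear map on the tensor product induced by a bilinear map \<open>f\<close>.\<close>

definition tlift ::
  "('k::field \<Rightarrow> 'v \<Rightarrow> 'v::ab_group_add) \<Rightarrow> (('x \<Rightarrow>\<^sub>0 'k) \<Rightarrow> ('y \<Rightarrow>\<^sub>0 'k) \<Rightarrow> 'v) \<Rightarrow> ('x \<times> 'y \<Rightarrow>\<^sub>0 'k) \<Rightarrow> 'v" where
  "tlift s f = lin_ext s (\<lambda>(x, y). f (bvec x) (bvec y))"

lemma lookup_tensor [simp]: "coef (p \<otimes> q) (x, y) = coef p x * coef q y"
proof -
  have "coef (p \<otimes> q) (x, y) =
      (\<Sum>a\<in>supp p. \<Sum>b\<in>supp q. if a = x \<and> b = y then coef p x * coef q y else 0)"
    unfolding tensor_def lookup_sum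
    by (intro sum.cong refl) (auto simp: lookup_single when_def)
  also have "\<dots> = (\<Sum>a\<in>supp p. if a = x then
      (\<Sum>b\<in>supp q. if b = y then coef p x * coef q y else 0) else 0)"
    by (intro sum.cong refl) auto
  also have "\<dots> = coef p x * coef q y"
    by (simp add: sum.delta in_keys_iff)
  finally show ?thesis .
qed

lemma lin_ext_superset:
  assumes "vector_space s" "finite X" "supp p \<subseteq> X"
  shows "lin_ext s f p = (\<Sum>x\<in>X. s (coef p x) (f x))"
proof -
  interpret vector_space s by fact
  show ?thesis unfolding lin_ext_def
    using assms(2,3) by (intro sum.mono_neutral_left) (auto simp: in_keys_iff)
qed

lemma linear_lin_ext:
  fixes s :: "'k::field \<Rightarrow> 'v \<Rightarrow> 'v::ab_group_add" and f :: "'x \<Rightarrow> 'v"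
  assumes "vector_space s"
  shows "Vector_Spaces.linear scl s (lin_ext s f)"
proof -
  interpret v: vector_space s by fact
  show ?thesis
  proof unfold_locales
    fix p q :: "'x \<Rightarrow>\<^sub>0 'k"
    let ?X = "supp p \<union> supp q"
    have "supp (p + q) \<subseteq> ?X" by (rule keys_add)
    then show "lin_ext s f (p + q) = lin_ext s f p + lin_ext s f q"
      by (simp add: lin_ext_superset[OF assms, of ?X] lookup_add v.scale_left_distrib sum.distrib)
  next
    fix c and p :: "'x \<Rightarrow>\<^sub>0 'k"
    have "supp (scl c p) \<subseteq> supp p" by (auto simp: in_keys_iff)
    then show "lin_ext s f (scl c p) = s c (lin_ext s f p)"
      by (simp add: lin_ext_superset[OF assms, of "supp p"] v.scale_sum_right)
  qed
qed

lemma bvec_expansion: "p = (\<Sum>x\<in>supp p. scl (coef p x) (bvec x))"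
  by (rule poly_mapping_eqI)
     (simp add: lookup_sum lookup_single when_def if_distrib[where f = "(*) _"] in_keys_iff
        cong: if_cong)

lemma linear_ext_unique:
  assumes "Vector_Spaces.linear scl s f" "Vector_Spaces.linear scl s g" "\<And>x. f (bvec x) = g (bvec x)"
  shows "f = g"
proof
  fix p
  interpret f: Vector_Spaces.linear scl s f by fact
  interpret g: Vector_Spaces.linear scl s g by fact
  show "f p = g p"
    by (subst (1 2) bvec_expansion) (simp add: f.sum g.sum f.scale g.scale assms(3))
qed

lemma coordinates_iso:
  assumes "vector_space s" and ind: "\<not> module.dependent s (range b)"
    and spn: "module.span s (range b) = UNIV" and "inj b"
  shows "Vector_Spaces.linear scl s (lin_ext s b)" "bij (lin_ext s b)"
proof -
  interpret v: vector_space s by fact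
  show lin: "Vector_Spaces.linear scl s (lin_ext s b)" by (rule linear_lin_ext) fact
  interpret l: Vector_Spaces.linear scl s "lin_ext s b" by fact
  have "p = 0" if "lin_ext s b p = 0" for p
  proof (rule poly_mapping_eqI)
    fix x
    define u where "u = (\<lambda>y. coef p (inv b y))"
    have "(\<Sum>y\<in>b ` supp p. s (u y) y) = 0"
      using that \<open>inj b\<close>
      by (subst sum.reindex) (auto intro: inj_on_subset simp: u_def lin_ext_def)
    then have "\<forall>y\<in>b ` supp p. u y = 0"
      using ind unfolding v.dependent_explicit
      by (auto dest!: spec[of _ "b ` supp p"] spec[of _ u])
    then show "coef p x = coef 0 x"
      using \<open>inj b\<close> by (cases "x \<in> supp p") (auto simp: u_def in_keys_iff)
  qed
  then have "p = q" if "lin_ext s b p = lin_ext s b q" for p q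
    using that l.diff[of p q] by (metis eq_iff_diff_eq_0)
  then have "inj (lin_ext s b)" by (rule injI)
  moreover have "v.span (range b) \<subseteq> range (lin_ext s b)"
  proof (rule v.span_minimal)
    have "lin_ext s b (bvec x) = b x" for x by (simp add: lin_ext_def)
    then show "range b \<subseteq> range (lin_ext s b)" by (metis image_subsetI rangeI)
    show "v.subspace (range (lin_ext s b))"
      by (intro l.subspace_image kvec.subspace_UNIV)
  qed
  ultimately show "bij (lin_ext s b)" using spn by (auto simp: bij_def)
qed

lemma linear_tensor_left: "Vector_Spaces.linear scl scl (\<lambda>p. p \<otimes> q)"
  by unfold_locales (auto intro!: poly_mapping_eqI simp: lookup_add algebra_simps)

lemma linear_tensor_right: "Vector_Spaces.linear scl scl (\<lambda>q. p \<otimes> q)"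
  by unfold_locales (auto intro!: poly_mapping_eqI simp: lookup_add algebra_simps)

lemma bvec_tensor: "bvec x \<otimes> bvec y = bvec (x, y)"
  by (rule poly_mapping_eqI) (auto simp: lookup_single when_def split: if_splits)

lemma linear_tlift: "vector_space s \<Longrightarrow> Vector_Spaces.linear scl s (tlift s f)"
  unfolding tlift_def by (rule linear_lin_ext)

lemma tlift_tensor:
  assumes "vector_space s" and l: "\<And>q. Vector_Spaces.linear scl s (\<lambda>p. f p q)" and r: "\<And>p. Vector_Spaces.linear scl s (f p)"
  shows "tlift s f (p \<otimes> q) = f p q"
proof -
  interpret t: Vector_Spaces.linear scl s "tlift s f" by (rule linear_tlift) fact
  have b: "tlift s f (bvec x \<otimes> bvec y) = f (bvec x) (bvec y)" for x y
    unfolding bvec_tensor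
    using assms(1) by (simp add: tlift_def lin_ext_def vector_space.vector_space_assms(4))
  have comp: "Vector_Spaces.linear scl s (\<lambda>p. tlift s f (p \<otimes> q))" for q
    using Vector_Spaces.linear_compose[OF linear_tensor_left t.linear_axioms] by (simp add: o_def)
  have comp': "Vector_Spaces.linear scl s (\<lambda>q. tlift s f (p \<otimes> q))" for p
    using Vector_Spaces.linear_compose[OF linear_tensor_right t.linear_axioms] by (simp add: o_def)
  have "(\<lambda>q. tlift s f (bvec x \<otimes> q)) = f (bvec x)" for x
    by (rule linear_ext_unique[OF comp' r]) (rule b)
  then have "(\<lambda>p. tlift s f (p \<otimes> q)) = (\<lambda>p. f p q)" 
    by (intro linear_ext_unique[OF comp l]) (auto dest: fun_cong)
  then show ?thesis by (rule fun_cong)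
qed

lemma tensor_ext:
  assumes "Vector_Spaces.linear scl s f" "Vector_Spaces.linear scl s g" "\<And>p q. f (p \<otimes> q) = g (p \<otimes> q)"
  shows "f = g"
  using assms(1,2) by (rule linear_ext_unique) (metis assms(3) bvec_tensor surj_pair)

subsection \<open>Structural maps\<close>

definition tmap :: "(('x \<Rightarrow>\<^sub>0 'k::field) \<Rightarrow> ('u \<Rightarrow>\<^sub>0 'k)) \<Rightarrow> (('y \<Rightarrow>\<^sub>0 'k) \<Rightarrow> ('v \<Rightarrow>\<^sub>0 'k)) \<Rightarrow>
    ('x \<times> 'y \<Rightarrow>\<^sub>0 'k) \<Rightarrow> ('u \<times> 'v \<Rightarrow>\<^sub>0 'k)" (infixr "\<otimes>\<^sub>m" 75) where
  "f \<otimes>\<^sub>m g = tlift scl (\<lambda>p q. f p \<otimes> g q)"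

definition rebase :: "('x \<Rightarrow> 'y) \<Rightarrow> ('x \<Rightarrow>\<^sub>0 'k::field) \<Rightarrow> ('y \<Rightarrow>\<^sub>0 'k)" where
  "rebase \<sigma> = lin_ext scl (\<lambda>x. bvec (\<sigma> x))"

definition assoc :: "(('x \<times> 'y) \<times> 'z \<Rightarrow>\<^sub>0 'k::field) \<Rightarrow> ('x \<times> 'y \<times> 'z \<Rightarrow>\<^sub>0 'k)" where
  "assoc = rebase (\<lambda>((x, y), z). (x, (y, z)))"

definition flip :: "('x \<times> 'y \<Rightarrow>\<^sub>0 'k::field) \<Rightarrow> ('y \<times> 'x \<Rightarrow>\<^sub>0 'k)" where
  "flip = rebase (\<lambda>(x, y). (y, x))"

definition flip23 :: "(('x \<times> 'y) \<times> 'z \<Rightarrow>\<^sub>0 'k::field) \<Rightarrow> (('x \<times> 'z) \<times> 'y \<Rightarrow>\<^sub>0 'k)" where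
  "flip23 = rebase (\<lambda>((x, y), z). ((x, z), y))"

text \<open>
  \<open>inner f\<close> is \<open>id \<otimes> f \<otimes> id\<close> from \<open>(U \<otimes> V) \<otimes> (W \<otimes> Z)\<close> to \<open>(U \<otimes> V') \<otimes> (W' \<otimes> Z)\<close>, for
  \<open>f : V \<otimes> W \<rightarrow> V' \<otimes> W'\<close>; the two \<open>rebase\<close> maps only move brackets.
\<close>

definition inner :: "(('v \<times> 'w \<Rightarrow>\<^sub>0 'k::field) \<Rightarrow> ('v1 \<times> 'w1 \<Rightarrow>\<^sub>0 'k)) \<Rightarrow>
    (('u \<times> 'v) \<times> ('w \<times> 'z) \<Rightarrow>\<^sub>0 'k) \<Rightarrow> (('u \<times> 'v1) \<times> ('w1 \<times> 'z) \<Rightarrow>\<^sub>0 'k)" where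
  "inner f = rebase (\<lambda>(u, ((v, w), z)). ((u, v), (w, z))) \<circ> (id \<otimes>\<^sub>m (f \<otimes>\<^sub>m id))
     \<circ> rebase (\<lambda>((u, v), (w, z)). (u, ((v, w), z)))"


section \<open>Algebras, coalgebras, Hopf algebras\<close>

text \<open>The field \<open>one\<close> is the value at \<open>1\<close> of the unit map from the ground field.\<close>

record (overloaded) ('x, 'k) bialg =
  mult :: "('x \<times> 'x \<Rightarrow>\<^sub>0 'k::field) \<Rightarrow> ('x \<Rightarrow>\<^sub>0 'k)"
  one :: "'x \<Rightarrow>\<^sub>0 'k"
  comult :: "('x \<Rightarrow>\<^sub>0 'k) \<Rightarrow> ('x \<times> 'x \<Rightarrow>\<^sub>0 'k)"
  counit :: "('x \<Rightarrow>\<^sub>0 'k) \<Rightarrow> 'k"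

definition is_algebra :: "('x, 'k::field, 'r) bialg_scheme \<Rightarrow> bool" where
  "is_algebra A \<longleftrightarrow> Vector_Spaces.linear scl scl (mult A)
     \<and> mult A \<circ> (mult A \<otimes>\<^sub>m id) = mult A \<circ> (id \<otimes>\<^sub>m mult A) \<circ> assoc
     \<and> (\<forall>a. mult A (one A \<otimes> a) = a) \<and> (\<forall>a. mult A (a \<otimes> one A) = a)"

text \<open>\<open>kl e\<close> is \<open>e \<otimes> id\<close> and \<open>kr e\<close> is \<open>id \<otimes> e\<close> for a linear form \<open>e\<close>, with \<open>k \<otimes> V\<close> and
  \<open>V \<otimes> k\<close> identified with \<open>V\<close>.\<close>

definition kl :: "(('x \<Rightarrow>\<^sub>0 'k::field) \<Rightarrow> 'k) \<Rightarrow> ('x \<times> 'y \<Rightarrow>\<^sub>0 'k) \<Rightarrow> ('y \<Rightarrow>\<^sub>0 'k)" where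
  "kl e = tlift scl (\<lambda>p q. scl (e p) q)"

definition kr :: "(('y \<Rightarrow>\<^sub>0 'k::field) \<Rightarrow> 'k) \<Rightarrow> ('x \<times> 'y \<Rightarrow>\<^sub>0 'k) \<Rightarrow> ('x \<Rightarrow>\<^sub>0 'k)" where
  "kr e = tlift scl (\<lambda>p q. scl (e q) p)"

definition is_coalgebra :: "('x, 'k::field, 'r) bialg_scheme \<Rightarrow> bool" where
  "is_coalgebra A \<longleftrightarrow> Vector_Spaces.linear scl scl (comult A) \<and> Vector_Spaces.linear scl (*) (counit A)
     \<and> assoc \<circ> (comult A \<otimes>\<^sub>m id) \<circ> comult A = (id \<otimes>\<^sub>m comult A) \<circ> comult A
     \<and> kl (counit A) \<circ> comult A = id \<and> kr (counit A) \<circ> comult A = id"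

text \<open>Bialgebra with respect to a braiding \<open>c\<close> of the underlying space with itself; ordinary
  bialgebras are obtained for \<open>c = flip\<close>.\<close>

definition is_bialgebra ::
  "(('x \<times> 'x \<Rightarrow>\<^sub>0 'k::field) \<Rightarrow> ('x \<times> 'x \<Rightarrow>\<^sub>0 'k)) \<Rightarrow> ('x, 'k, 'r) bialg_scheme \<Rightarrow> bool" where
  "is_bialgebra c A \<longleftrightarrow> is_algebra A \<and> is_coalgebra A
     \<and> comult A \<circ> mult A = (mult A \<otimes>\<^sub>m mult A) \<circ> inner c \<circ> (comult A \<otimes>\<^sub>m comult A)
     \<and> comult A (one A) = one A \<otimes> one A
     \<and> (\<forall>a b. counit A (mult A (a \<otimes> b)) = counit A a * counit A b)
     \<and> counit A (one A) = 1"

definition is_antipode :: "('x, 'k::field, 'r) bialg_scheme \<Rightarrow> (('x \<Rightarrow>\<^sub>0 'k) \<Rightarrow> ('x \<Rightarrow>\<^sub>0 'k)) \<Rightarrow> bool" where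
  "is_antipode A S \<longleftrightarrow> Vector_Spaces.linear scl scl S
     \<and> mult A \<circ> (S \<otimes>\<^sub>m id) \<circ> comult A = (\<lambda>a. scl (counit A a) (one A))
     \<and> mult A \<circ> (id \<otimes>\<^sub>m S) \<circ> comult A = (\<lambda>a. scl (counit A a) (one A))"

definition hopf_bij_antipode :: "('b, 'k::field) bialg \<Rightarrow> bool" where
  "hopf_bij_antipode B \<longleftrightarrow> is_bialgebra flip B \<and> (\<exists>S. is_antipode B S \<and> bij S)"

definition left_module ::
  "('x, 'k::field, 'r) bialg_scheme \<Rightarrow> (('x \<times> 'v \<Rightarrow>\<^sub>0 'k) \<Rightarrow> ('v \<Rightarrow>\<^sub>0 'k)) \<Rightarrow> bool" where
  "left_module A \<alpha> \<longleftrightarrow> Vector_Spaces.linear scl scl \<alpha>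
     \<and> \<alpha> \<circ> (mult A \<otimes>\<^sub>m id) = \<alpha> \<circ> (id \<otimes>\<^sub>m \<alpha>) \<circ> assoc \<and> (\<forall>v. \<alpha> (one A \<otimes> v) = v)"

definition right_module ::
  "('x, 'k::field, 'r) bialg_scheme \<Rightarrow> (('v \<times> 'x \<Rightarrow>\<^sub>0 'k) \<Rightarrow> ('v \<Rightarrow>\<^sub>0 'k)) \<Rightarrow> bool" where
  "right_module A \<beta> \<longleftrightarrow> Vector_Spaces.linear scl scl \<beta>
     \<and> \<beta> \<circ> (\<beta> \<otimes>\<^sub>m id) = \<beta> \<circ> (id \<otimes>\<^sub>m mult A) \<circ> assoc \<and> (\<forall>v. \<beta> (v \<otimes> one A) = v)"

definition left_comodule ::
  "('x, 'k::field, 'r) bialg_scheme \<Rightarrow> (('v \<Rightarrow>\<^sub>0 'k) \<Rightarrow> ('x \<times> 'v \<Rightarrow>\<^sub>0 'k)) \<Rightarrow> bool" where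
  "left_comodule A \<phi> \<longleftrightarrow> Vector_Spaces.linear scl scl \<phi>
     \<and> assoc \<circ> (comult A \<otimes>\<^sub>m id) \<circ> \<phi> = (id \<otimes>\<^sub>m \<phi>) \<circ> \<phi> \<and> kl (counit A) \<circ> \<phi> = id"

definition right_comodule ::
  "('x, 'k::field, 'r) bialg_scheme \<Rightarrow> (('v \<Rightarrow>\<^sub>0 'k) \<Rightarrow> ('v \<times> 'x \<Rightarrow>\<^sub>0 'k)) \<Rightarrow> bool" where
  "right_comodule A \<psi> \<longleftrightarrow> Vector_Spaces.linear scl scl \<psi>
     \<and> assoc \<circ> (\<psi> \<otimes>\<^sub>m id) \<circ> \<psi> = (id \<otimes>\<^sub>m comult A) \<circ> \<psi> \<and> kr (counit A) \<circ> \<psi> = id"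


section \<open>Left Yetter--Drinfeld modules\<close>

record (overloaded) ('b, 'x, 'k) yd =
  act :: "('b \<times> 'x \<Rightarrow>\<^sub>0 'k::field) \<Rightarrow> ('x \<Rightarrow>\<^sub>0 'k)"
  coact :: "('x \<Rightarrow>\<^sub>0 'k) \<Rightarrow> ('b \<times> 'x \<Rightarrow>\<^sub>0 'k)"

text \<open>
  The last condition is
  \<open>b\<^sub>1 v\<^sub>-\<^sub>1 \<otimes> b\<^sub>2 v\<^sub>0 = (b\<^sub>1 v)\<^sub>-\<^sub>1 b\<^sub>2 \<otimes> (b\<^sub>1 v)\<^sub>0\<close>.
\<close>

definition yd_module :: "('b, 'k::field) bialg \<Rightarrow> ('b, 'x, 'k) yd \<Rightarrow> bool" where
  "yd_module B V \<longleftrightarrow> left_module B (act V) \<and> left_comodule B (coact V)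
     \<and> (mult B \<otimes>\<^sub>m act V) \<circ> inner flip \<circ> (comult B \<otimes>\<^sub>m coact V)
       = (mult B \<otimes>\<^sub>m id) \<circ> flip23 \<circ> ((coact V \<circ> act V) \<otimes>\<^sub>m id) \<circ> flip23 \<circ> (comult B \<otimes>\<^sub>m id)"

definition yd_hom ::
  "('b, 'x, 'k::field) yd \<Rightarrow> ('b, 'y, 'k) yd \<Rightarrow> (('x \<Rightarrow>\<^sub>0 'k) \<Rightarrow> ('y \<Rightarrow>\<^sub>0 'k)) \<Rightarrow> bool" where
  "yd_hom V W f \<longleftrightarrow> Vector_Spaces.linear scl scl f
     \<and> f \<circ> act V = act W \<circ> (id \<otimes>\<^sub>m f) \<and> coact W \<circ> f = (id \<otimes>\<^sub>m f) \<circ> coact V"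

definition yd_tensor ::
  "('b, 'k::field) bialg \<Rightarrow> ('b, 'x, 'k) yd \<Rightarrow> ('b, 'y, 'k) yd \<Rightarrow> ('b, 'x \<times> 'y, 'k) yd" where
  "yd_tensor B V W = \<lparr>
     act = (act V \<otimes>\<^sub>m act W) \<circ> inner flip \<circ> (comult B \<otimes>\<^sub>m id),
     coact = (mult B \<otimes>\<^sub>m id) \<circ> inner flip \<circ> (coact V \<otimes>\<^sub>m coact W)\<rparr>"

text \<open>The braiding \<open>C(v \<otimes> w) = v\<^sub>-\<^sub>1 w \<otimes> v\<^sub>0\<close>.\<close>

definition braiding :: "('b, 'x, 'k::field) yd \<Rightarrow> ('b, 'y, 'k) yd \<Rightarrow>
    ('x \<times> 'y \<Rightarrow>\<^sub>0 'k) \<Rightarrow> ('y \<times> 'x \<Rightarrow>\<^sub>0 'k)" where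
  "braiding V W = (act W \<otimes>\<^sub>m id) \<circ> flip23 \<circ> (coact V \<otimes>\<^sub>m id)"


section \<open>Braided Hopf algebras\<close>

record (overloaded) ('b, 'x, 'k) braided = "('x, 'k::field) bialg" +
  yd_str :: "('b, 'x, 'k) yd"

text \<open>
  The last four conditions say that the unit and the counit are Yetter--Drinfeld morphisms, where
  the ground field has the action \<open>b c = \<epsilon>(b) c\<close> and the coaction \<open>c \<mapsto> 1 \<otimes> c\<close>.
\<close>

definition braided_bialgebra :: "('b, 'k::field) bialg \<Rightarrow> ('b, 'x, 'k) braided \<Rightarrow> bool" where
  "braided_bialgebra B A \<longleftrightarrow> yd_module B (yd_str A)
     \<and> is_bialgebra (braiding (yd_str A) (yd_str A)) A
     \<and> yd_hom (yd_tensor B (yd_str A) (yd_str A)) (yd_str A) (mult A)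
     \<and> yd_hom (yd_str A) (yd_tensor B (yd_str A) (yd_str A)) (comult A)
     \<and> (\<forall>b. act (yd_str A) (b \<otimes> one A) = scl (counit B b) (one A))
     \<and> coact (yd_str A) (one A) = one B \<otimes> one A
     \<and> (\<forall>b a. counit A (act (yd_str A) (b \<otimes> a)) = counit B b * counit A a)
     \<and> (\<forall>a. kr (counit A) (coact (yd_str A) a) = scl (counit A a) (one B))"

definition braided_hopf :: "('b, 'k::field) bialg \<Rightarrow> ('b, 'x, 'k) braided \<Rightarrow> bool" where
  "braided_hopf B A \<longleftrightarrow> braided_bialgebra B A
     \<and> (\<exists>S. is_antipode A S \<and> yd_hom (yd_str A) (yd_str A) S)"

definition fin_dim :: "('b, 'x, 'k::field) braided \<Rightarrow> bool" where
  "fin_dim A \<longleftrightarrow> (\<exists>X :: ('x \<Rightarrow>\<^sub>0 'k) set. finite X \<and> kvec.span X = UNIV)"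

definition left_integral :: "('b, 'x, 'k::field) braided \<Rightarrow> ('x \<Rightarrow>\<^sub>0 'k) \<Rightarrow> bool" where
  "left_integral A \<Lambda> \<longleftrightarrow> (\<forall>h. mult A (h \<otimes> \<Lambda>) = scl (counit A h) \<Lambda>)"

definition right_integral :: "('b, 'x, 'k::field) braided \<Rightarrow> ('x \<Rightarrow>\<^sub>0 'k) \<Rightarrow> bool" where
  "right_integral A \<Lambda> \<longleftrightarrow> (\<forall>h. mult A (\<Lambda> \<otimes> h) = scl (counit A h) \<Lambda>)"

definition left_ideal :: "('b, 'x, 'k::field) braided \<Rightarrow> ('x \<Rightarrow>\<^sub>0 'k) set \<Rightarrow> bool" where
  "left_ideal A I \<longleftrightarrow> kvec.subspace I \<and> (\<forall>a. \<forall>x\<in>I. mult A (a \<otimes> x) \<in> I)"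

text \<open>Semisimplicity of the underlying \<open>k\<close>-algebra: every submodule of the left regular module is
  a direct summand.\<close>

definition semisimple :: "('b, 'x, 'k::field) braided \<Rightarrow> bool" where
  "semisimple A \<longleftrightarrow> (\<forall>I. left_ideal A I \<longrightarrow>
     (\<exists>J. left_ideal A J \<and> I \<inter> J = {0} \<and> (\<forall>a. \<exists>x\<in>I. \<exists>y\<in>J. a = x + y)))"


section \<open>Double bicrossproducts\<close>

definition left_module_coalgebra :: "('b, 'y, 'k::field) braided \<Rightarrow> ('b, 'x, 'k) braided \<Rightarrow>
    (('y \<times> 'x \<Rightarrow>\<^sub>0 'k) \<Rightarrow> ('x \<Rightarrow>\<^sub>0 'k)) \<Rightarrow> bool" where
  "left_module_coalgebra H A \<alpha> \<longleftrightarrow> left_module H \<alpha>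
     \<and> comult A \<circ> \<alpha> = (\<alpha> \<otimes>\<^sub>m \<alpha>) \<circ> inner (braiding (yd_str H) (yd_str A)) \<circ> (comult H \<otimes>\<^sub>m comult A)
     \<and> (\<forall>h a. counit A (\<alpha> (h \<otimes> a)) = counit H h * counit A a)"

definition right_module_coalgebra :: "('b, 'x, 'k::field) braided \<Rightarrow> ('b, 'y, 'k) braided \<Rightarrow>
    (('y \<times> 'x \<Rightarrow>\<^sub>0 'k) \<Rightarrow> ('y \<Rightarrow>\<^sub>0 'k)) \<Rightarrow> bool" where
  "right_module_coalgebra A H \<beta> \<longleftrightarrow> right_module A \<beta>
     \<and> comult H \<circ> \<beta> = (\<beta> \<otimes>\<^sub>m \<beta>) \<circ> inner (braiding (yd_str H) (yd_str A)) \<circ> (comult H \<otimes>\<^sub>m comult A)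
     \<and> (\<forall>h a. counit H (\<beta> (h \<otimes> a)) = counit H h * counit A a)"

definition left_comodule_algebra :: "('b, 'y, 'k::field) braided \<Rightarrow> ('b, 'x, 'k) braided \<Rightarrow>
    (('x \<Rightarrow>\<^sub>0 'k) \<Rightarrow> ('y \<times> 'x \<Rightarrow>\<^sub>0 'k)) \<Rightarrow> bool" where
  "left_comodule_algebra H A \<phi> \<longleftrightarrow> left_comodule H \<phi>
     \<and> \<phi> \<circ> mult A = (mult H \<otimes>\<^sub>m mult A) \<circ> inner (braiding (yd_str A) (yd_str H)) \<circ> (\<phi> \<otimes>\<^sub>m \<phi>)
     \<and> \<phi> (one A) = one H \<otimes> one A"

definition right_comodule_algebra :: "('b, 'x, 'k::field) braided \<Rightarrow> ('b, 'y, 'k) braided \<Rightarrow>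
    (('y \<Rightarrow>\<^sub>0 'k) \<Rightarrow> ('y \<times> 'x \<Rightarrow>\<^sub>0 'k)) \<Rightarrow> bool" where
  "right_comodule_algebra A H \<psi> \<longleftrightarrow> right_comodule A \<psi>
     \<and> \<psi> \<circ> mult H = (mult H \<otimes>\<^sub>m mult A) \<circ> inner (braiding (yd_str A) (yd_str H)) \<circ> (\<psi> \<otimes>\<^sub>m \<psi>)
     \<and> \<psi> (one H) = one H \<otimes> one A"

definition bicross_data :: "('b, 'k::field) bialg \<Rightarrow> ('b, 'x, 'k) braided \<Rightarrow> ('b, 'y, 'k) braided \<Rightarrow>
    (('y \<times> 'x \<Rightarrow>\<^sub>0 'k) \<Rightarrow> ('x \<Rightarrow>\<^sub>0 'k)) \<Rightarrow> (('y \<times> 'x \<Rightarrow>\<^sub>0 'k) \<Rightarrow> ('y \<Rightarrow>\<^sub>0 'k)) \<Rightarrow>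
    (('x \<Rightarrow>\<^sub>0 'k) \<Rightarrow> ('y \<times> 'x \<Rightarrow>\<^sub>0 'k)) \<Rightarrow> (('y \<Rightarrow>\<^sub>0 'k) \<Rightarrow> ('y \<times> 'x \<Rightarrow>\<^sub>0 'k)) \<Rightarrow> bool" where
  "bicross_data B A H \<alpha> \<beta> \<phi> \<psi> \<longleftrightarrow>
     yd_hom (yd_tensor B (yd_str H) (yd_str A)) (yd_str A) \<alpha>
     \<and> yd_hom (yd_tensor B (yd_str H) (yd_str A)) (yd_str H) \<beta>
     \<and> yd_hom (yd_str A) (yd_tensor B (yd_str H) (yd_str A)) \<phi>
     \<and> yd_hom (yd_str H) (yd_tensor B (yd_str H) (yd_str A)) \<psi>
     \<and> left_module_coalgebra H A \<alpha> \<and> right_module_coalgebra A H \<beta>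
     \<and> left_comodule_algebra H A \<phi> \<and> right_comodule_algebra A H \<psi>"

definition double_bicross :: "('b, 'k::field) bialg \<Rightarrow> ('b, 'x, 'k) braided \<Rightarrow> ('b, 'y, 'k) braided \<Rightarrow>
    (('y \<times> 'x \<Rightarrow>\<^sub>0 'k) \<Rightarrow> ('x \<Rightarrow>\<^sub>0 'k)) \<Rightarrow> (('y \<times> 'x \<Rightarrow>\<^sub>0 'k) \<Rightarrow> ('y \<Rightarrow>\<^sub>0 'k)) \<Rightarrow>
    (('x \<Rightarrow>\<^sub>0 'k) \<Rightarrow> ('y \<times> 'x \<Rightarrow>\<^sub>0 'k)) \<Rightarrow> (('y \<Rightarrow>\<^sub>0 'k) \<Rightarrow> ('y \<times> 'x \<Rightarrow>\<^sub>0 'k)) \<Rightarrow>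
    ('b, 'x \<times> 'y, 'k) braided" where
  "double_bicross B A H \<alpha> \<beta> \<phi> \<psi> = \<lparr>
     mult = (mult A \<otimes>\<^sub>m mult H) \<circ> inner (\<alpha> \<otimes>\<^sub>m \<beta>)
       \<circ> inner (inner (braiding (yd_str H) (yd_str A))) \<circ> inner (comult H \<otimes>\<^sub>m comult A),
     one = one A \<otimes> one H,
     comult = inner (mult H \<otimes>\<^sub>m mult A) \<circ> inner (inner (braiding (yd_str A) (yd_str H)))
       \<circ> inner (\<phi> \<otimes>\<^sub>m \<psi>) \<circ> (comult A \<otimes>\<^sub>m comult H),
     counit = tlift (*) (\<lambda>a h. counit A a * counit H h),
     yd_str = yd_tensor B (yd_str A) (yd_str H)\<rparr>"

end

theory Submission
  imports Defs
begin

text \<open>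
  The unit axiom of \<open>D\<close> forces \<open>\<beta>(1 \<otimes> b) = \<epsilon>(b) 1\<close> and \<open>\<alpha>(h \<otimes> 1) = \<epsilon>(h) 1\<close>, so that
  \<open>(a \<otimes> 1)(b \<otimes> g) = ab \<otimes> g\<close> and \<open>(b \<otimes> g)(1 \<otimes> h) = b \<otimes> gh\<close> (\<open>mult_D_A\<close>, \<open>mult_D_H\<close>). Hence every
  slice of a left integral of \<open>D\<close> along a coordinate of \<open>H\<close> is a left integral of \<open>A\<close>, and every
  slice of a right integral along a coordinate of \<open>A\<close> is a right integral of \<open>H\<close>. Since integrals
  are unique up to a scalar, this gives the two factorisations; if both integrals of \<open>D\<close> agree,
  comparing them gives \<open>x \<Lambda>\<^sub>A \<otimes> \<Lambda>\<^sub>H\<close>. The statements on semisimplicity follow by applying the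
  counit \<open>\<epsilon>\<^sub>A \<otimes> \<epsilon>\<^sub>H\<close>, once Maschke's theorem is known: a finite-dimensional braided Hopf algebra
  is semisimple if and only if \<open>\<epsilon>(\<Lambda>) \<noteq> 0\<close> for a nonzero integral \<open>\<Lambda>\<close>.

  Two facts about a single finite-dimensional braided Hopf algebra thus carry the proof.

  Uniqueness (\<open>integral_unique\<close>). Let \<open>\<Lambda> \<noteq> 0\<close> be a left integral. Braiding \<open>h\<close> past \<open>\<Lambda>\<^sub>1\<close> and
  multiplying it to \<open>\<Lambda>\<^sub>2\<close> yields \<open>S(h) \<Lambda>\<^sub>1 \<otimes> \<Lambda>\<^sub>2\<close>, by \<open>\<Delta>(h \<Lambda>) = \<epsilon>(h) \<Delta>(\<Lambda>)\<close> and the antipode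
  axiom. As the braiding can be undone by partial dualisation, the space of all \<open>f(\<Lambda>\<^sub>1) \<Lambda>\<^sub>2\<close> is a
  left ideal. It contains \<open>S(r\<^sub>1) r\<^sub>2 = \<epsilon>(r) 1\<close> for each of its elements \<open>r\<close>, and some \<open>\<epsilon>(r)\<close> is
  nonzero, so it is everything; counting dimensions, \<open>f \<mapsto> f(\<Lambda>\<^sub>1) \<Lambda>\<^sub>2\<close> is bijective. The form \<open>l\<close>
  with \<open>l(\<Lambda>\<^sub>1) \<Lambda>\<^sub>2 = 1\<close> then satisfies \<open>l(v\<^sub>1) v\<^sub>2 = l(v) 1\<close> for all \<open>v\<close>. A left integral \<open>\<Lambda>''\<close> with
  \<open>l(\<Lambda>'') = 0\<close> therefore has \<open>l(\<Lambda>''\<^sub>1) \<Lambda>''\<^sub>2 = 0\<close> and must vanish, since otherwise its own bijection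
  would kill \<open>l\<close>. So the left integrals form a line. Right integrals are the left integrals for the
  reversed multiplication, comultiplication and braiding.

  Maschke's theorem (\<open>maschke\<close>). An integral with \<open>\<epsilon>(\<Lambda>) \<noteq> 0\<close> is two-sided, and by uniqueness it
  is invariant under \<open>B\<close>, so every element braids trivially past it. Then \<open>\<Lambda>\<^sub>1 \<otimes> S(\<Lambda>\<^sub>2)\<close> commutes
  with all elements and averages any linear projection to a projection of modules. Conversely, a
  complement of the kernel of \<open>\<epsilon>\<close> consists of integrals.
\<close>

section \<open>Sweedler sums\<close>

abbreviation lin :: "(('x \<Rightarrow>\<^sub>0 'k::field) \<Rightarrow> ('y \<Rightarrow>\<^sub>0 'k)) \<Rightarrow> bool" where
  "lin \<equiv> Vector_Spaces.linear scl scl"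

abbreviation lform :: "(('x \<Rightarrow>\<^sub>0 'k::field) \<Rightarrow> 'k) \<Rightarrow> bool" where
  "lform \<equiv> Vector_Spaces.linear scl (*)"

text \<open>
  The sum \<open>\<Sum> F(t\<^sub>1, t\<^sub>2)\<close> of Sweedler's notation. The map \<open>F\<close> is evaluated on basis vectors only, so
  the sum is linear in \<open>t\<close> for every \<open>F\<close>; bilinearity of \<open>F\<close> is the price for evaluating it at
  elementary tensors (\<open>sw_tensor\<close>).
\<close>

abbreviation sw :: "('x \<times> 'y \<Rightarrow>\<^sub>0 'k::field) \<Rightarrow> (('x \<Rightarrow>\<^sub>0 'k) \<Rightarrow> ('y \<Rightarrow>\<^sub>0 'k) \<Rightarrow> ('z \<Rightarrow>\<^sub>0 'k)) \<Rightarrow> ('z \<Rightarrow>\<^sub>0 'k)"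
  where "sw t F \<equiv> tlift scl F t"

named_theorems lin_rules

lemma vs_scl: "vector_space (scl :: 'k::field \<Rightarrow> ('x \<Rightarrow>\<^sub>0 'k) \<Rightarrow> _)"
  by (rule kvec.vector_space_axioms)

lemma vs_field: "vector_space ((*) :: 'k::field \<Rightarrow> 'k \<Rightarrow> 'k)"
  by unfold_locales (auto simp: algebra_simps)

lemma linI:
  assumes "\<And>p q. f (p + q) = f p + f q" "\<And>c p. f (scl c p) = scl c (f p)"
  shows "lin f"
  using assms by unfold_locales auto

lemma lformI:
  assumes "\<And>p q. f (p + q) = f p + f q" "\<And>c p. f (scl c p) = c * f p"
  shows "lform f"
  using assms by unfold_locales (auto simp: algebra_simps)

lemma lin_add: "lin f \<Longrightarrow> f (p + q) = f p + f q"
  and lin_scl: "lin f \<Longrightarrow> f (scl c p) = scl c (f p)"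
  and lin_0: "lin f \<Longrightarrow> f 0 = 0"
  and lin_diff: "lin f \<Longrightarrow> f (p - q) = f p - f q"
  and lin_sum: "lin f \<Longrightarrow> f (sum g X) = (\<Sum>x\<in>X. f (g x))"
proof -
  assume "lin f"
  then interpret Vector_Spaces.linear scl scl f .
  show "f (p + q) = f p + f q" "f (scl c p) = scl c (f p)" "f 0 = 0" "f (p - q) = f p - f q"
    "f (sum g X) = (\<Sum>x\<in>X. f (g x))"
    by (simp_all add: add scale diff sum)
qed

lemma lform_add: "lform f \<Longrightarrow> f (p + q) = f p + f q"
  and lform_scl: "lform f \<Longrightarrow> f (scl c p) = c * f p"
  and lform_0: "lform f \<Longrightarrow> f 0 = 0"
  and lform_diff: "lform f \<Longrightarrow> f (p - q) = f p - f q"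
  and lform_sum: "lform f \<Longrightarrow> f (sum g X) = (\<Sum>x\<in>X. f (g x))"
proof -
  assume "lform f"
  then interpret Vector_Spaces.linear scl "(*)" f .
  show "f (p + q) = f p + f q" "f (scl c p) = c * f p" "f 0 = 0" "f (p - q) = f p - f q"
    "f (sum g X) = (\<Sum>x\<in>X. f (g x))"
    by (simp_all add: add scale diff sum)
qed

lemma lform_coef: "lform (\<lambda>p. coef p x)"
  by (rule lformI) (auto simp: lookup_add)

lemma lin_id [lin_rules]: "lin (\<lambda>p. p)" by (rule linI) auto

lemma lin_comp: "lin f \<Longrightarrow> lin g \<Longrightarrow> lin (\<lambda>x. f (g x))"
  by (rule linI) (auto simp: lin_add lin_scl)

lemma lform_comp: "lform f \<Longrightarrow> lin g \<Longrightarrow> lform (\<lambda>x. f (g x))"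
  by (rule lformI) (auto simp: lin_add lin_scl lform_add lform_scl)

lemma lin_scl_right [lin_rules]: "lin g \<Longrightarrow> lin (\<lambda>x. scl c (g x))"
  by (rule linI) (auto simp: lin_add lin_scl kvec.scale_scale kvec.scale_right_distrib mult.commute)

lemma lin_scl_left [lin_rules]: "lform f \<Longrightarrow> lin (\<lambda>x. scl (f x) v)"
  by (rule linI) (auto simp: lform_add lform_scl kvec.scale_scale kvec.scale_left_distrib)

lemma lin_tensor_left [lin_rules]: "lin g \<Longrightarrow> lin (\<lambda>x. g x \<otimes> p)"
  by (rule lin_comp[OF linear_tensor_left])

lemma lin_tensor_right [lin_rules]: "lin g \<Longrightarrow> lin (\<lambda>x. p \<otimes> g x)"
  by (rule lin_comp[OF linear_tensor_right])

lemma lin_sw_left [lin_rules]: "lin g \<Longrightarrow> lin (\<lambda>x. sw (g x) F)"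
  by (rule lin_comp[OF linear_tlift[OF vs_scl]])

lemma sw_expand: "sw t F = (\<Sum>xy\<in>supp t. scl (coef t xy) (F (bvec (fst xy)) (bvec (snd xy))))"
  by (simp add: tlift_def lin_ext_def case_prod_beta)

lemma lin_setsum [lin_rules]: "(\<And>i. lin (\<lambda>x. F x i)) \<Longrightarrow> lin (\<lambda>x. \<Sum>i\<in>I. F x i)"
proof (rule linI)
  assume l: "\<And>i. lin (\<lambda>x. F x i)"
  show "(\<Sum>i\<in>I. F (p + q) i) = (\<Sum>i\<in>I. F p i) + (\<Sum>i\<in>I. F q i)" for p q
    by (simp add: lin_add[OF l] sum.distrib)
  show "(\<Sum>i\<in>I. F (scl c p) i) = scl c (\<Sum>i\<in>I. F p i)" for c p
    by (simp add: lin_scl[OF l] kvec.scale_sum_right)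
qed

lemma lin_sw_right [lin_rules]: "(\<And>p q. lin (\<lambda>x. F x p q)) \<Longrightarrow> lin (\<lambda>x. sw t (F x))"
  unfolding sw_expand by (intro lin_rules)

lemma sw_tensor:
  assumes "\<And>q. lin (\<lambda>p. F p q)" "\<And>p. lin (F p)"
  shows "sw (p \<otimes> q) F = F p q"
  by (rule tlift_tensor[OF vs_scl assms])

lemma lin_sw: "lin L \<Longrightarrow> L (sw t F) = sw t (\<lambda>p q. L (F p q))"
  unfolding sw_expand by (subst lin_sum, assumption) (intro sum.cong refl, rule lin_scl)

lemma sw_sw: "sw (sw t F) G = sw t (\<lambda>p q. sw (F p q) G)"
  by (rule lin_sw[OF linear_tlift[OF vs_scl]])

lemma sw_swap: "sw t (\<lambda>p q. sw s (G p q)) = sw s (\<lambda>u v. sw t (\<lambda>p q. G p q u v))"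
  unfolding sw_expand kvec.scale_sum_right
  by (subst sum.swap) (simp add: kvec.scale_scale mult.commute)

lemma sw_add: "sw t (\<lambda>p q. F p q + G p q) = sw t F + sw t G"
  by (simp add: sw_expand kvec.scale_right_distrib sum.distrib)

lemma sw_sum: "sw t (\<lambda>p q. \<Sum>i\<in>I. F i p q) = (\<Sum>i\<in>I. sw t (F i))"
  unfolding sw_expand kvec.scale_sum_right by (rule sum.swap)

lemma sw_scl: "sw t (\<lambda>p q. scl c (F p q)) = scl c (sw t F)"
  by (rule lin_sw[symmetric, OF lin_scl_right[OF lin_id]])

lemma sw_diff: "sw t (\<lambda>p q. F p q - G p q) = sw t F - sw t G"
  by (simp add: sw_expand kvec.scale_right_diff_distrib sum_subtractf)

lemma tmap_tensor: "lin f \<Longrightarrow> lin g \<Longrightarrow> (f \<otimes>\<^sub>m g) (p \<otimes> q) = f p \<otimes> g q"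
  unfolding tmap_def by (rule sw_tensor) (simp_all add: lin_rules lin_comp[of f] lin_comp[of g])

lemma lin_tmap [lin_rules]: "lin h \<Longrightarrow> lin (\<lambda>x. (f \<otimes>\<^sub>m g) (h x))"
  unfolding tmap_def by (intro lin_rules)

lemma tmap_sw: "(f \<otimes>\<^sub>m g) t = sw t (\<lambda>p q. f p \<otimes> g q)"
  by (simp add: tmap_def)

lemma lin_rebase [lin_rules]: "lin g \<Longrightarrow> lin (\<lambda>x. rebase \<sigma> (g x))"
  unfolding rebase_def by (rule lin_comp[OF linear_lin_ext[OF vs_scl]])

lemma rebase_bvec [simp]: "rebase \<sigma> (bvec x) = bvec (\<sigma> x)"
  by (simp add: rebase_def lin_ext_def)

lemma lin_eq_bvec: "lin f \<Longrightarrow> lin g \<Longrightarrow> (\<And>x. f (bvec x) = g (bvec x)) \<Longrightarrow> f p = g p"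
  using linear_ext_unique[of scl f g] by (auto dest: fun_cong)

lemma lin_eq_tensor: "lin f \<Longrightarrow> lin g \<Longrightarrow> (\<And>p q. f (p \<otimes> q) = g (p \<otimes> q)) \<Longrightarrow> f t = g t"
  using tensor_ext[of scl f g] by (auto dest: fun_cong)

lemma lin_flip [lin_rules]: "lin g \<Longrightarrow> lin (\<lambda>x. flip (g x))"
  unfolding flip_def by (rule lin_rebase)

lemma flip_tensor [simp]: "flip (p \<otimes> q) = q \<otimes> (p :: _ \<Rightarrow>\<^sub>0 'k::field)"
proof -
  have 1: "flip (p \<otimes> bvec y) = bvec y \<otimes> p" for y and p :: "'z \<Rightarrow>\<^sub>0 'k"
    by (rule lin_eq_bvec[of "\<lambda>p. flip (p \<otimes> bvec y)" "\<lambda>p. bvec y \<otimes> p"])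
       (simp_all add: lin_rules flip_def bvec_tensor)
  show ?thesis
    by (rule lin_eq_bvec[of "\<lambda>q. flip (p \<otimes> q)" "\<lambda>q. q \<otimes> p"])
       (simp_all add: 1 lin_rules)
qed

lemma flip_eq_sw: "flip t = sw t (\<lambda>p q. q \<otimes> p)"
  by (rule lin_eq_tensor[of flip]) (simp_all add: sw_tensor lin_rules)

lemma sw_bvec [simp]: "sw (bvec (x, y)) F = F (bvec x) (bvec y)"
  by (simp add: sw_expand kvec.scale_one)

lemma sw_flip [simp]: "sw (flip t) F = sw t (\<lambda>p q. F q p)"
proof (rule lin_eq_bvec[of "\<lambda>t. sw (flip t) F"])
  show "sw (flip (bvec x)) F = sw (bvec x) (\<lambda>p q. F q p)" for x
    by (cases x) (simp add: flip_def)
qed (simp_all add: lin_rules)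

lemma sw_assoc: "sw (assoc t) (\<lambda>p w. sw w (F p)) = sw t (\<lambda>w r. sw w (\<lambda>p q. F p q r))"
proof (rule lin_eq_bvec[of "\<lambda>t. sw (assoc t) (\<lambda>p w. sw w (F p))"])
  show "sw (assoc (bvec x)) (\<lambda>p w. sw w (F p)) = sw (bvec x) (\<lambda>w r. sw w (\<lambda>p q. F p q r))" for x
    by (cases x) (auto simp: assoc_def)
qed (simp_all add: lin_rules assoc_def)

lemma lin_inner [lin_rules]: "lin g \<Longrightarrow> lin (\<lambda>x. inner f (g x))"
  unfolding inner_def o_def by (intro lin_rules)

lemma lin_eq_bvec3:
  assumes "\<And>v w. lin (\<lambda>u. f u v w)" "\<And>u w. lin (\<lambda>v. f u v w)" "\<And>u v. lin (\<lambda>w. f u v w)"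
    "\<And>v w. lin (\<lambda>u. g u v w)" "\<And>u w. lin (\<lambda>v. g u v w)" "\<And>u v. lin (\<lambda>w. g u v w)"
    "\<And>x y s. f (bvec x) (bvec y) (bvec s) = g (bvec x) (bvec y) (bvec s)"
  shows "f u v w = g u v w"
proof -
  have "f u (bvec y) (bvec s) = g u (bvec y) (bvec s)" for u y s
    by (rule lin_eq_bvec[OF assms(1,4,7)])
  then have "f u v (bvec s) = g u v (bvec s)" for u v s
    by (rule lin_eq_bvec[OF assms(2,5)])
  then show ?thesis
    by (rule lin_eq_bvec[OF assms(3,6)])
qed

lemma lin_eq_bvec4:
  assumes "\<And>v w z. lin (\<lambda>u. f u v w z)" "\<And>u w z. lin (\<lambda>v. f u v w z)" "\<And>u v z. lin (\<lambda>w. f u v w z)"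
    "\<And>u v w. lin (\<lambda>z. f u v w z)"
    "\<And>v w z. lin (\<lambda>u. g u v w z)" "\<And>u w z. lin (\<lambda>v. g u v w z)" "\<And>u v z. lin (\<lambda>w. g u v w z)"
    "\<And>u v w. lin (\<lambda>z. g u v w z)"
    "\<And>x y s t. f (bvec x) (bvec y) (bvec s) (bvec t) = g (bvec x) (bvec y) (bvec s) (bvec t)"
  shows "f u v w z = g u v w z"
proof -
  have "f u v w (bvec t) = g u v w (bvec t)" for u v w t
    by (rule lin_eq_bvec3[of "\<lambda>u v w. f u v w (bvec t)", OF assms(1,2,3,5,6,7,9)])
  then show ?thesis
    by (rule lin_eq_bvec[OF assms(4,8)])
qed

lemma inner_tensor:
  assumes "lin f"
  shows "inner f ((u \<otimes> v) \<otimes> (w \<otimes> z)) = sw (f (v \<otimes> w)) (\<lambda>v' w'. (u \<otimes> v') \<otimes> (w' \<otimes> z))"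
proof (rule lin_eq_bvec4[of "\<lambda>u v w z. inner f ((u \<otimes> v) \<otimes> (w \<otimes> z))"], goal_cases)
  case (9 x y s t)
  have 1: "rebase (\<lambda>(u, (v, w), z). ((u, v), w, z)) (bvec x \<otimes> r \<otimes> bvec t) =
     sw r (\<lambda>v' w'. (bvec x \<otimes> v') \<otimes> (w' \<otimes> bvec t))" for r
    by (rule lin_eq_bvec[of "\<lambda>r. rebase (\<lambda>(u, (v, w), z). ((u, v), w, z)) (bvec x \<otimes> r \<otimes> bvec t)"])
      (auto simp: lin_rules bvec_tensor)
  have "inner f ((bvec x \<otimes> bvec y) \<otimes> (bvec s \<otimes> bvec t)) =
      rebase (\<lambda>(u, (v, w), z). ((u, v), w, z))
       ((id \<otimes>\<^sub>m f \<otimes>\<^sub>m id) (bvec x \<otimes> bvec (y, s) \<otimes> bvec t))"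
    by (simp add: inner_def bvec_tensor)
  also have "\<dots> = rebase (\<lambda>(u, (v, w), z). ((u, v), w, z)) (bvec x \<otimes> f (bvec (y, s)) \<otimes> bvec t)"
    using assms by (simp add: tmap_tensor lin_rules id_def)
  finally show ?case by (simp add: 1 bvec_tensor)
qed (simp_all add: lin_rules lin_comp[OF assms])

lemma lin_id' [lin_rules]: "lin id"
  using lin_id by (simp add: id_def)

lemma lin_assoc [lin_rules]: "lin g \<Longrightarrow> lin (\<lambda>x. assoc (g x))"
  unfolding assoc_def by (rule lin_rebase)

lemma lin_flip23 [lin_rules]: "lin g \<Longrightarrow> lin (\<lambda>x. flip23 (g x))"
  unfolding flip23_def by (rule lin_rebase)

lemma assoc_tensor: "assoc ((u \<otimes> v) \<otimes> w) = u \<otimes> v \<otimes> w"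
  by (rule lin_eq_bvec3[of "\<lambda>u v w. assoc ((u \<otimes> v) \<otimes> w)"])
    (simp_all add: lin_rules assoc_def bvec_tensor)

lemma flip23_tensor: "flip23 ((u \<otimes> v) \<otimes> w) = (u \<otimes> w) \<otimes> v"
  by (rule lin_eq_bvec3[of "\<lambda>u v w. flip23 ((u \<otimes> v) \<otimes> w)"])
    (simp_all add: lin_rules flip23_def bvec_tensor)

lemma inner_sw:
  assumes "lin f"
  shows "inner f (t \<otimes> s) = sw t (\<lambda>u v. sw s (\<lambda>w z. sw (f (v \<otimes> w)) (\<lambda>v' w'. (u \<otimes> v') \<otimes> (w' \<otimes> z))))"
proof (rule lin_eq_tensor[of "\<lambda>t. inner f (t \<otimes> s)"])
  fix u v
  show "inner f ((u \<otimes> v) \<otimes> s) = sw (u \<otimes> v) (\<lambda>u v. sw s (\<lambda>w z. sw (f (v \<otimes> w)) (\<lambda>v' w'. (u \<otimes> v') \<otimes> (w' \<otimes> z))))"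
    by (rule lin_eq_tensor[of "\<lambda>s. inner f ((u \<otimes> v) \<otimes> s)"])
      (simp_all add: lin_rules inner_tensor assms sw_tensor lin_comp[OF assms])
qed (simp_all add: lin_rules)

lemma sw_cong: "(\<And>x y. F (bvec x) (bvec y) = G (bvec x) (bvec y)) \<Longrightarrow> sw t F = sw t G"
  by (simp add: sw_expand)

lemma sw_tensor_bvec_right:
  "(\<And>y. lin (\<lambda>w. G w (bvec y))) \<Longrightarrow> sw (t \<otimes> bvec y) G = G t (bvec y)"
  by (rule lin_eq_bvec[of "\<lambda>t. sw (t \<otimes> bvec y) G"]) (simp_all add: lin_rules bvec_tensor)

lemma sw_tensor_bvec_left:
  "(\<And>x. lin (G (bvec x))) \<Longrightarrow> sw (bvec x \<otimes> t) G = G (bvec x) t"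
  by (rule lin_eq_bvec[of "\<lambda>t. sw (bvec x \<otimes> t) G"]) (simp_all add: lin_rules bvec_tensor)

lemma lin_lookup [lin_rules]: "lin g \<Longrightarrow> lin (\<lambda>x. scl (coef (g x) z) v)"
  by (rule lin_scl_left[OF lform_comp[OF lform_coef]])

lemma lin_kl [lin_rules]: "lin g \<Longrightarrow> lin (\<lambda>x. kl f (g x))"
  unfolding kl_def by (intro lin_rules)

lemma lin_kr [lin_rules]: "lin g \<Longrightarrow> lin (\<lambda>x. kr f (g x))"
  unfolding kr_def by (intro lin_rules)

lemma kl_tensor: "lform f \<Longrightarrow> kl f (p \<otimes> q) = scl (f p) q"
  unfolding kl_def by (rule sw_tensor) (simp_all add: lin_rules lin_scl_left)

lemma kr_tensor: "lform f \<Longrightarrow> kr f (p \<otimes> q) = scl (f q) p"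
  unfolding kr_def by (rule sw_tensor) (simp_all add: lin_rules lin_scl_left)

text \<open>
  The maps \<open>d\<close> and \<open>e\<close> are kept apart to cover comodules as well, where \<open>d\<close> is the comultiplication
  and \<open>e\<close> the coaction.
\<close>

lemma coassoc_sw:
  assumes "assoc (sw s (\<lambda>w r. d w \<otimes> r)) = sw t (\<lambda>p w. p \<otimes> e w)"
  shows "sw s (\<lambda>w r. sw (d w) (\<lambda>p q. F p q r)) = sw t (\<lambda>p w. sw (e w) (\<lambda>q r. F p q r))"
proof -
  have "sw (assoc (sw s (\<lambda>w r. d w \<otimes> r))) (\<lambda>p w. sw w (F p)) =
      sw s (\<lambda>w r. sw (d w \<otimes> r) (\<lambda>w r. sw w (\<lambda>p q. F p q r)))"
    by (simp add: sw_assoc sw_sw)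
  also have "\<dots> = sw s (\<lambda>w r. sw (d w) (\<lambda>p q. F p q r))"
    by (rule sw_cong) (simp add: sw_tensor_bvec_right lin_rules)
  moreover have "sw (sw t (\<lambda>p w. p \<otimes> e w)) (\<lambda>p w. sw w (F p)) =
      sw t (\<lambda>p w. sw (e w) (\<lambda>q r. F p q r))"
    unfolding sw_sw by (rule sw_cong) (simp add: sw_tensor_bvec_left lin_rules)
  ultimately show ?thesis using assms by simp
qed

section \<open>Integrals in a braided Hopf algebra\<close>

text \<open>
  Only one object is involved here, so the ambient category is reduced to a self-braiding \<open>c\<close>.
  The last axiom is what remains of rigidity: the map \<open>V\<^sup>* \<otimes> V \<rightarrow> Hom(V, V)\<close> that sends
  \<open>g \<otimes> k\<close> to \<open>x \<mapsto> (g \<otimes> id)(c(k \<otimes> x))\<close> hits every map of rank one. Axioms of this form survive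
  the reversal of all structure maps (\<open>opposite\<close>), so one proof serves left and right integrals.
\<close>

locale prebraided_hopf =
  fixes mul :: "('x \<Rightarrow>\<^sub>0 'k::field) \<Rightarrow> ('x \<Rightarrow>\<^sub>0 'k) \<Rightarrow> ('x \<Rightarrow>\<^sub>0 'k)"
    and un :: "'x \<Rightarrow>\<^sub>0 'k"
    and \<Delta> :: "('x \<Rightarrow>\<^sub>0 'k) \<Rightarrow> ('x \<times> 'x \<Rightarrow>\<^sub>0 'k)"
    and \<epsilon> :: "('x \<Rightarrow>\<^sub>0 'k) \<Rightarrow> 'k"
    and S :: "('x \<Rightarrow>\<^sub>0 'k) \<Rightarrow> ('x \<Rightarrow>\<^sub>0 'k)"
    and c :: "('x \<times> 'x \<Rightarrow>\<^sub>0 'k) \<Rightarrow> ('x \<times> 'x \<Rightarrow>\<^sub>0 'k)"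
  assumes fin: "finite (UNIV :: 'x set)"
    and mul_l: "lin (\<lambda>a. mul a b)" and mul_r: "lin (\<lambda>b. mul a b)"
    and mul_assoc: "mul (mul a b) d = mul a (mul b d)"
    and mul_one_left: "mul un a = a" and mul_one_right: "mul a un = a"
    and lin_\<Delta>: "lin \<Delta>" and lform_\<epsilon>: "lform \<epsilon>"
    and \<Delta>_assoc: "assoc (sw (\<Delta> a) (\<lambda>w r. \<Delta> w \<otimes> r)) = sw (\<Delta> a) (\<lambda>p w. p \<otimes> \<Delta> w)"
    and counit_left: "sw (\<Delta> a) (\<lambda>p q. scl (\<epsilon> p) q) = a"
    and counit_right: "sw (\<Delta> a) (\<lambda>p q. scl (\<epsilon> q) p) = a"
    and lin_S: "lin S"
    and S_left: "sw (\<Delta> a) (\<lambda>p q. mul (S p) q) = scl (\<epsilon> a) un"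
    and S_right: "sw (\<Delta> a) (\<lambda>p q. mul p (S q)) = scl (\<epsilon> a) un"
    and lin_c: "lin c"
    and \<Delta>_mul: "\<Delta> (mul a b) = sw (\<Delta> a) (\<lambda>a1 a2. sw (\<Delta> b) (\<lambda>b1 b2.
                  sw (c (a2 \<otimes> b1)) (\<lambda>y z. mul a1 y \<otimes> mul z b2)))"
    and \<Delta>_one: "\<Delta> un = un \<otimes> un"
    and \<epsilon>_mul: "\<epsilon> (mul a b) = \<epsilon> a * \<epsilon> b" and \<epsilon>_one: "\<epsilon> un = 1"
    and rigid: "lform f \<Longrightarrow> \<exists>ps. (\<forall>(g, k)\<in>set ps. lform g) \<and>
                  (\<forall>x. scl (f x) h = (\<Sum>(g, k)\<leftarrow>ps. kl g (c (k \<otimes> x))))"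
begin

lemmas coassoc = coassoc_sw[OF \<Delta>_assoc]

lemmas lin_facts = lin_rules lin_comp[OF mul_l] lin_comp[OF mul_r] mul_l mul_r lin_\<Delta> lin_comp[OF lin_\<Delta>]
  lin_scl_left[OF lform_\<epsilon>] lin_scl_left[OF lform_comp[OF lform_\<epsilon>]] lin_S lin_comp[OF lin_S]
  lin_c lin_comp[OF lin_c]

definition integral :: "('x \<Rightarrow>\<^sub>0 'k) \<Rightarrow> bool" where
  "integral \<Lambda> \<longleftrightarrow> (\<forall>h. mul h \<Lambda> = scl (\<epsilon> h) \<Lambda>)"

text \<open>
  Write \<open>S(h) = S(h\<^sub>1) \<epsilon>(h\<^sub>2)\<close>, absorb \<open>\<epsilon>(h\<^sub>2)\<close> into \<open>\<Delta>(h\<^sub>2 \<Lambda>)\<close>, expand, and cancel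
  \<open>S(h\<^sub>1) h\<^sub>2\<close>.
\<close>

lemma integral_shift:
  assumes "integral \<Lambda>"
  shows "sw (\<Delta> \<Lambda>) (\<lambda>p q. sw (c (h \<otimes> p)) (\<lambda>y z. y \<otimes> mul z q)) = sw (\<Delta> \<Lambda>) (\<lambda>p q. mul (S h) p \<otimes> q)"
proof -
  define K where "K g t = sw t (\<lambda>p q. mul g p \<otimes> q)" for g and t :: "'x \<times> 'x \<Rightarrow>\<^sub>0 'k"
  define N where "N g h3 = sw (\<Delta> \<Lambda>) (\<lambda>p q. sw (c (h3 \<otimes> p)) (\<lambda>y z. mul g y \<otimes> mul z q))" for g h3
  have Kl: "lin (\<lambda>g. K g t)" and Kr: "lin (K g)" for g t
    unfolding K_def by (simp_all add: lin_facts)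
  have Nl: "lin (\<lambda>g. N g t)" and Nr: "lin (N g)" for g t
    unfolding N_def by (simp_all add: lin_facts)
  have \<Delta>m: "\<Delta> (mul w \<Lambda>) = sw (\<Delta> w) (\<lambda>h2 h3. N h2 h3)" for w
    by (simp add: \<Delta>_mul N_def)
  have KN: "K g (N h2 h3) = N (mul g h2) h3" for g h2 h3
    unfolding K_def N_def by (simp add: sw_sw sw_tensor lin_facts mul_assoc)
  have "K (S h) (\<Delta> \<Lambda>) = K (S (sw (\<Delta> h) (\<lambda>p q. scl (\<epsilon> q) p))) (\<Delta> \<Lambda>)"
    by (simp add: counit_right)
  also have "\<dots> = sw (\<Delta> h) (\<lambda>h1 w. K (S (scl (\<epsilon> w) h1)) (\<Delta> \<Lambda>))"
    by (rule lin_sw[of "\<lambda>h. K (S h) (\<Delta> \<Lambda>)"]) (rule lin_comp[OF Kl lin_S])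
  also have "\<dots> = sw (\<Delta> h) (\<lambda>h1 w. K (S h1) (\<Delta> (mul w \<Lambda>)))"
    using assms by (simp add: integral_def lin_scl[OF lin_S] lin_scl[OF Kl] lin_scl[OF Kr] lin_scl[OF lin_\<Delta>])
  also have "\<dots> = sw (\<Delta> h) (\<lambda>h1 w. sw (\<Delta> w) (\<lambda>h2 h3. N (mul (S h1) h2) h3))"
    by (simp add: \<Delta>m lin_sw[OF Kr] KN)
  also have "\<dots> = sw (\<Delta> h) (\<lambda>w h3. sw (\<Delta> w) (\<lambda>h1 h2. N (mul (S h1) h2) h3))"
    by (rule coassoc[symmetric])
  also have "\<dots> = sw (\<Delta> h) (\<lambda>w h3. N (scl (\<epsilon> w) un) h3)"
    by (simp add: lin_sw[OF Nl, symmetric] S_left)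
  also have "\<dots> = sw (\<Delta> h) (\<lambda>w h3. N un (scl (\<epsilon> w) h3))"
    by (simp add: lin_scl[OF Nl] lin_scl[OF Nr])
  also have "\<dots> = N un h"
    by (simp add: lin_sw[OF Nr, symmetric] counit_left)
  finally show ?thesis by (simp add: K_def N_def mul_one_left)
qed

text \<open>The right leg of the tensor \<open>\<Delta>(\<Lambda>)\<close>.\<close>

definition legs :: "('x \<Rightarrow>\<^sub>0 'k) \<Rightarrow> ('x \<Rightarrow>\<^sub>0 'k) set" where
  "legs \<Lambda> = {kl f (\<Delta> \<Lambda>) | f. lform f}"

lemma legsI: "lform f \<Longrightarrow> kl f (\<Delta> \<Lambda>) \<in> legs \<Lambda>" by (auto simp: legs_def)

lemma legs_add: "u \<in> legs \<Lambda> \<Longrightarrow> v \<in> legs \<Lambda> \<Longrightarrow> u + v \<in> legs \<Lambda>"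
proof (unfold legs_def, safe)
  fix f g :: "('x \<Rightarrow>\<^sub>0 'k) \<Rightarrow> 'k" assume "lform f" "lform g"
  then have "lform (\<lambda>x. f x + g x)"
    by (intro lformI) (auto simp: lform_add lform_scl algebra_simps)
  moreover have "kl f (\<Delta> \<Lambda>) + kl g (\<Delta> \<Lambda>) = kl (\<lambda>x. f x + g x) (\<Delta> \<Lambda>)"
    by (simp add: kl_def kvec.scale_left_distrib sw_add)
  ultimately show "\<exists>h. kl f (\<Delta> \<Lambda>) + kl g (\<Delta> \<Lambda>) = kl h (\<Delta> \<Lambda>) \<and> lform h" by blast
qed

lemma legs_scl: "u \<in> legs \<Lambda> \<Longrightarrow> scl d u \<in> legs \<Lambda>"
proof (unfold legs_def, safe)
  fix f :: "('x \<Rightarrow>\<^sub>0 'k) \<Rightarrow> 'k" assume "lform f"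
  then have "lform (\<lambda>x. d * f x)"
    by (intro lformI) (auto simp: lform_add lform_scl algebra_simps)
  moreover have "scl d (kl f (\<Delta> \<Lambda>)) = kl (\<lambda>x. d * f x) (\<Delta> \<Lambda>)"
    by (simp add: kl_def sw_scl[symmetric] kvec.scale_scale)
  ultimately show "\<exists>h. scl d (kl f (\<Delta> \<Lambda>)) = kl h (\<Delta> \<Lambda>) \<and> lform h" by blast
qed

lemma legs_0: "0 \<in> legs \<Lambda>"
  using legs_scl[OF legsI[OF lform_coef], of 0] by simp

lemma legs_subspace: "kvec.subspace (legs \<Lambda>)"
  by (rule kvec.subspaceI) (auto intro: legs_0 legs_add legs_scl)

text \<open>
  Rigidity rewrites \<open>f(\<Lambda>\<^sub>1) h\<close> through the braiding, after which \<open>integral_shift\<close> turns the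
  multiplication on \<open>\<Lambda>\<^sub>2\<close> into one on \<open>\<Lambda>\<^sub>1\<close>, where it only changes the linear form.
\<close>

lemma legs_mul:
  assumes "integral \<Lambda>" "u \<in> legs \<Lambda>"
  shows "mul h u \<in> legs \<Lambda>"
proof -
  from assms(2) obtain f where f: "lform f" and u: "u = kl f (\<Delta> \<Lambda>)" by (auto simp: legs_def)
  from rigid[OF f, of h] obtain ps where ps: "\<And>g k. (g, k) \<in> set ps \<Longrightarrow> lform g"
    and eq: "\<And>x. scl (f x) h = (\<Sum>(g, k)\<leftarrow>ps. kl g (c (k \<otimes> x)))" by blast
  have "mul h u = sw (\<Delta> \<Lambda>) (\<lambda>p q. mul (scl (f p) h) q)"
    unfolding u kl_def lin_sw[OF mul_r]
    by (rule sw_cong) (simp add: lin_scl[OF mul_l] lin_scl[OF mul_r])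
  also have "\<dots> = sw (\<Delta> \<Lambda>) (\<lambda>p q. mul (\<Sum>(g, k)\<leftarrow>ps. kl g (c (k \<otimes> p))) q)"
    by (simp add: eq)
  also have "\<dots> = (\<Sum>(g, k)\<leftarrow>ps. sw (\<Delta> \<Lambda>) (\<lambda>p q. mul (kl g (c (k \<otimes> p))) q))"
  proof (induction ps)
    case Nil
    then show ?case by (simp add: lin_0[OF mul_l] sw_expand)
  next
    case (Cons a ps)
    then show ?case by (simp add: lin_add[OF mul_l] sw_add case_prod_beta)
  qed
  also have "\<dots> = (\<Sum>(g, k)\<leftarrow>ps. kl (\<lambda>p. g (mul (S k) p)) (\<Delta> \<Lambda>))"
  proof (intro arg_cong[of _ _ sum_list] map_cong refl, clarify)
    fix g k assume "(g, k) \<in> set ps"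
    then have g: "lform g" by (rule ps)
    have "sw (\<Delta> \<Lambda>) (\<lambda>p q. mul (kl g (c (k \<otimes> p))) q) =
        kl g (sw (\<Delta> \<Lambda>) (\<lambda>p q. sw (c (k \<otimes> p)) (\<lambda>y z. y \<otimes> mul z q)))"
      unfolding lin_sw[OF lin_kl[OF lin_id]] kl_tensor[OF g]
      by (simp add: kl_def lin_sw[OF mul_l] lin_scl[OF mul_l])
    also have "\<dots> = kl (\<lambda>p. g (mul (S k) p)) (\<Delta> \<Lambda>)"
      unfolding integral_shift[OF assms(1)] lin_sw[OF lin_kl[OF lin_id]] kl_tensor[OF g]
      by (simp add: kl_def)
    finally show "sw (\<Delta> \<Lambda>) (\<lambda>p q. mul (kl g (c (k \<otimes> p))) q) = kl (\<lambda>p. g (mul (S k) p)) (\<Delta> \<Lambda>)" .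
  qed
  also have "\<dots> \<in> legs \<Lambda>"
    using ps
  proof (induction ps)
    case Nil
    then show ?case by (simp add: legs_0)
  next
    case (Cons a ps)
    obtain g k where a: "a = (g, k)" by (cases a)
    have "lform g" using Cons.prems[of g k] by (simp add: a)
    then have "kl (\<lambda>p. g (mul (S k) p)) (\<Delta> \<Lambda>) \<in> legs \<Lambda>" by (rule legsI[OF lform_comp[OF _ mul_r]])
    moreover have "(\<Sum>(g, k)\<leftarrow>ps. kl (\<lambda>p. g (mul (S k) p)) (\<Delta> \<Lambda>)) \<in> legs \<Lambda>"
      by (rule Cons.IH) (use Cons.prems in auto)
    ultimately show ?case by (simp add: a legs_add)
  qed
  finally show ?thesis .
qed

text \<open>
  For \<open>r = f(\<Lambda>\<^sub>1) \<Lambda>\<^sub>2\<close> the element \<open>\<epsilon>(r) 1 = S(r\<^sub>1) r\<^sub>2\<close> lies in the left ideal, because \<open>r\<^sub>2\<close>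
  does; and \<open>\<epsilon>(r) = f(\<Lambda>)\<close> is nonzero for a suitable coordinate \<open>f\<close>.
\<close>

lemma one_in_legs:
  assumes "integral \<Lambda>" "\<Lambda> \<noteq> 0"
  shows "un \<in> legs \<Lambda>"
proof -
  obtain x where x: "coef \<Lambda> x \<noteq> 0" using assms(2) by (metis lookup_zero poly_mapping_eqI)
  define f :: "('x \<Rightarrow>\<^sub>0 'k) \<Rightarrow> 'k" where "f = (\<lambda>p. coef p x)"
  have f: "lform f" unfolding f_def by (rule lform_coef)
  have "scl (f \<Lambda>) un = scl (f (sw (\<Delta> \<Lambda>) (\<lambda>p q. scl (\<epsilon> q) p))) un"
    by (simp add: counit_right)
  also have "\<dots> = sw (\<Delta> \<Lambda>) (\<lambda>p q. scl (f p) (scl (\<epsilon> q) un))"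
    by (subst lin_sw[OF lin_scl_left[OF f]]) (simp add: lform_scl[OF f] kvec.scale_scale mult.commute)
  also have "\<dots> = sw (\<Delta> \<Lambda>) (\<lambda>p w. sw (\<Delta> w) (\<lambda>q r. scl (f p) (mul (S q) r)))"
    by (simp add: S_left[symmetric] sw_scl)
  also have "\<dots> = sw (\<Delta> \<Lambda>) (\<lambda>w r. sw (\<Delta> w) (\<lambda>p q. scl (f p) (mul (S q) r)))"
    by (rule coassoc[symmetric])
  also have "\<dots> = sw (\<Delta> \<Lambda>) (\<lambda>w r. mul (S (kl f (\<Delta> w))) r)"
    by (simp add: kl_def lin_sw[OF lin_S] lin_sw[OF mul_l] lin_scl[OF lin_S] lin_scl[OF mul_l])
  \<comment> \<open>Expanding the left factor in the basis leaves products with elements of the right leg.\<close>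
  also have "\<dots> = sw (\<Delta> \<Lambda>) (\<lambda>w r. mul (\<Sum>z\<in>UNIV. scl (coef (S (kl f (\<Delta> w))) z) (bvec z)) r)"
  proof -
    have "v = (\<Sum>z\<in>UNIV. scl (coef v z) (bvec z))" for v :: "'x \<Rightarrow>\<^sub>0 'k"
      by (subst bvec_expansion) (rule sum.mono_neutral_left, auto simp: fin in_keys_iff)
    then show ?thesis by simp
  qed
  also have "\<dots> = (\<Sum>z\<in>UNIV. mul (bvec z) (kl (\<lambda>w. coef (S (kl f (\<Delta> w))) z) (\<Delta> \<Lambda>)))"
    by (simp add: kl_def lin_sum[OF mul_l] lin_scl[OF mul_l] lin_scl[OF mul_r] sw_sum lin_sw[OF mul_r])
  also have "\<dots> \<in> legs \<Lambda>"
    by (intro kvec.subspace_sum[OF legs_subspace] legs_mul[OF assms(1)] legsI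
        lform_comp[OF lform_coef] lin_comp[OF lin_S] lin_kl lin_\<Delta>)
  finally have "scl (inverse (f \<Lambda>)) (scl (f \<Lambda>) un) \<in> legs \<Lambda>" by (rule legs_scl)
  then show ?thesis using x by (simp add: kvec.scale_scale f_def kvec.scale_one)
qed

lemma legs_UNIV:
  assumes "integral \<Lambda>" "\<Lambda> \<noteq> 0"
  shows "legs \<Lambda> = UNIV"
  using legs_mul[OF assms(1) one_in_legs[OF assms]] by (auto simp: mul_one_right)

text \<open>
  Linear forms and vectors have the same dimension, so the surjection \<open>f \<mapsto> f(\<Lambda>\<^sub>1) \<Lambda>\<^sub>2\<close> of
  \<open>legs_UNIV\<close> is injective. Linear forms are parametrised by their coefficient vectors to turn it into
  an endomorphism \<open>\<Phi>\<close>.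
\<close>

lemma kl_inj:
  assumes "integral \<Lambda>" "\<Lambda> \<noteq> 0" "lform f" "kl f (\<Delta> \<Lambda>) = 0"
  shows "f x = 0"
proof -
  define B where "B = range (bvec :: 'x \<Rightarrow> ('x \<Rightarrow>\<^sub>0 'k))"
  interpret fd: finite_dimensional_vector_space scl B
  proof unfold_locales
    show "finite B" using fin by (simp add: B_def)
    show "\<not> kvec.dependent B"
    proof (rule kvec.independent_if_scalars_zero[OF \<open>finite B\<close>])
      fix u :: "('x \<Rightarrow>\<^sub>0 'k) \<Rightarrow> 'k" and b assume *: "(\<Sum>v\<in>B. scl (u v) v) = 0" and "b \<in> B"
      then obtain z where b: "b = bvec z" by (auto simp: B_def)
      have "inj (bvec :: 'x \<Rightarrow> ('x \<Rightarrow>\<^sub>0 'k))" by (rule injI) (metis lookup_single_eq lookup_single_not_eq zero_neq_one)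
      then have "coef (\<Sum>v\<in>B. scl (u v) v) z = (\<Sum>y\<in>UNIV. if y = z then u (bvec y) else 0)"
        unfolding B_def by (subst sum.reindex) (auto simp: lookup_sum lookup_single when_def intro!: sum.cong)
      also have "\<dots> = u b" using fin b by simp
      finally show "u b = 0" using * by simp
    qed
    show "kvec.span B = UNIV"
    proof safe
      fix p :: "'x \<Rightarrow>\<^sub>0 'k"
      show "p \<in> kvec.span B"
        by (subst bvec_expansion, intro kvec.span_sum kvec.span_scale, rule kvec.span_base) (simp add: B_def)
    qed simp
  qed
  interpret fdp: finite_dimensional_vector_space_pair scl B scl B ..
  define \<Phi> where "\<Phi> g = kl (\<lambda>p. \<Sum>x\<in>UNIV. coef g x * coef p x) (\<Delta> \<Lambda>)" for g :: "'x \<Rightarrow>\<^sub>0 'k"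
  have "lin \<Phi>"
    unfolding \<Phi>_def kl_def
    by (intro lin_sw_right lin_scl_left lformI) (auto simp: lookup_add algebra_simps sum.distrib sum_distrib_left)
  have coord: "\<exists>g. f = (\<lambda>p. \<Sum>x\<in>UNIV. coef g x * coef p x)" if f: "lform f" for f :: "('x \<Rightarrow>\<^sub>0 'k) \<Rightarrow> 'k"
  proof -
    have "f p = (\<Sum>x\<in>UNIV. coef (\<Sum>y\<in>UNIV. scl (f (bvec y)) (bvec y)) x * coef p x)" for p
    proof -
      have "f p = (\<Sum>x\<in>supp p. coef p x * f (bvec x))"
        by (subst bvec_expansion) (simp add: lform_sum[OF f] lform_scl[OF f])
      also have "\<dots> = (\<Sum>x\<in>UNIV. coef p x * f (bvec x))"
        by (rule sum.mono_neutral_left) (auto simp: fin in_keys_iff)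
      also have "\<dots> = (\<Sum>x\<in>UNIV. coef (\<Sum>y\<in>UNIV. scl (f (bvec y)) (bvec y)) x * coef p x)"
        using fin by (simp add: lookup_sum lookup_single when_def mult.commute if_distrib[where f = "(*) _"] cong: if_cong)
      finally show ?thesis .
    qed
    then show ?thesis by blast
  qed
  have "surj \<Phi>"
  proof (unfold surj_def, rule allI)
    fix v
    have "v \<in> legs \<Lambda>" by (simp add: legs_UNIV[OF assms(1,2)])
    then obtain f where "lform f" "v = kl f (\<Delta> \<Lambda>)" by (auto simp: legs_def)
    with coord[of f] show "\<exists>g. v = \<Phi> g" by (auto simp: \<Phi>_def)
  qed
  then have "inj \<Phi>" by (intro fdp.linear_surjective_imp_injective[OF \<open>lin \<Phi>\<close>]) simp_all
  obtain g where g: "f = (\<lambda>p. \<Sum>x\<in>UNIV. coef g x * coef p x)" using coord[OF assms(3)] by blast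
  then have "\<Phi> g = \<Phi> 0" using assms(4) lin_0[OF \<open>lin \<Phi>\<close>] by (simp add: \<Phi>_def)
  with \<open>inj \<Phi>\<close> have "g = 0" by (simp add: inj_eq)
  then show ?thesis by (simp add: g)
qed

lemma integral_unique:
  assumes "integral \<Lambda>" "\<Lambda> \<noteq> 0" "integral \<Lambda>'"
  obtains d where "\<Lambda>' = scl d \<Lambda>"
proof -
  obtain l where l: "lform l" and l1: "kl l (\<Delta> \<Lambda>) = un"
    using one_in_legs[OF assms(1,2)] by (auto simp: legs_def)
  \<comment> \<open>The convolution \<open>l * g\<close> and \<open>g(1) l\<close> have the same image \<open>g(1) 1\<close> under the bijection, so they agree.\<close>
  have conv: "scl (g (kl l (\<Delta> v))) un = scl (g un * l v) un" if g: "lform g" for g v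
  proof -
    let ?f = "\<lambda>v. g (kl l (\<Delta> v)) - g un * l v"
    have gl: "lform (\<lambda>v. g (kl l (\<Delta> v)))" by (rule lform_comp[OF g lin_kl[OF lin_\<Delta>]])
    have f: "lform ?f"
      by (rule lformI) (simp_all add: lform_add[OF gl] lform_scl[OF gl] lform_add[OF l] lform_scl[OF l]
          algebra_simps)
    have "kl (\<lambda>v. g (kl l (\<Delta> v))) (\<Delta> \<Lambda>) =
        sw (\<Delta> \<Lambda>) (\<lambda>w r. sw (\<Delta> w) (\<lambda>p q. scl (g (scl (l p) q)) r))"
      unfolding kl_def by (rule sw_cong) (rule lin_sw[OF lin_scl_left[OF g]])
    also have "\<dots> = sw (\<Delta> \<Lambda>) (\<lambda>p w. sw (\<Delta> w) (\<lambda>q r. scl (g (scl (l p) q)) r))"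
      by (rule coassoc)
    also have "\<dots> = sw (\<Delta> \<Lambda>) (\<lambda>p w. scl (l p) (kl g (\<Delta> w)))"
      unfolding kl_def lform_scl[OF g] kvec.scale_scale[symmetric] sw_scl ..
    also have "\<dots> = kl g (\<Delta> (kl l (\<Delta> \<Lambda>)))"
      unfolding kl_def[of l] lin_sw[OF lin_kl[OF lin_\<Delta>]]
      by (simp add: lin_scl[OF lin_kl[OF lin_\<Delta>]])
    also have "\<dots> = scl (g un) (kl l (\<Delta> \<Lambda>))"
      by (simp add: l1 \<Delta>_one kl_tensor[OF g])
    finally have "kl (\<lambda>v. g (kl l (\<Delta> v))) (\<Delta> \<Lambda>) = scl (g un) (kl l (\<Delta> \<Lambda>))" .
    then have "kl ?f (\<Delta> \<Lambda>) = 0"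
      unfolding kl_def kvec.scale_left_diff_distrib sw_diff kvec.scale_scale[symmetric] sw_scl by simp
    then have "?f v = 0" by (rule kl_inj[OF assms(1,2) f])
    then show ?thesis by simp
  qed
  have un: "un \<noteq> 0" using \<epsilon>_one lform_0[OF lform_\<epsilon>] by auto
  have conv': "kl l (\<Delta> v) = scl (l v) un" for v
  proof (rule poly_mapping_eqI)
    fix x
    obtain y where y: "coef un y \<noteq> 0" using un by (metis lookup_zero poly_mapping_eqI)
    have "coef (scl (coef (kl l (\<Delta> v)) x) un) y = coef (scl (coef un x * l v) un) y"
      by (simp only: conv[OF lform_coef])
    then show "coef (kl l (\<Delta> v)) x = coef (scl (l v) un) x" using y by simp
  qed
  have "l \<Lambda> = 1" 
    using conv'[of \<Lambda>] \<epsilon>_one lform_scl[OF lform_\<epsilon>, of "l \<Lambda>" un] by (simp add: l1)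
  \<comment> \<open>Since \<open>l(\<Lambda>) = 1\<close>, this is the component of \<open>\<Lambda>'\<close> on which \<open>l\<close> vanishes.\<close>
  define \<Lambda>'' where "\<Lambda>'' = \<Lambda>' - scl (l \<Lambda>') \<Lambda>"
  have "integral \<Lambda>''"
    using assms(1,3) by (simp add: integral_def \<Lambda>''_def lin_diff[OF mul_r] lin_scl[OF mul_r]
        kvec.scale_right_diff_distrib kvec.scale_scale mult.commute)
  moreover have "l \<Lambda>'' = 0"
    by (simp add: \<Lambda>''_def lform_diff[OF l] lform_scl[OF l] \<open>l \<Lambda> = 1\<close>)
  ultimately have "\<Lambda>'' = 0"
    using kl_inj[of \<Lambda>'' l \<Lambda>] conv'[of \<Lambda>''] l \<open>l \<Lambda> = 1\<close> by auto
  then show ?thesis using that[of "l \<Lambda>'"] by (simp add: \<Lambda>''_def)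
qed

text \<open>
  The Galois map \<open>p \<otimes> q \<mapsto> p\<^sub>1 \<otimes> p\<^sub>2 q\<close> has the inverse \<open>p \<otimes> q \<mapsto> p\<^sub>1 \<otimes> S(p\<^sub>2) q\<close>. It sends
  \<open>\<Lambda>\<^sub>1 \<otimes> S(\<Lambda>\<^sub>2) h\<close> to \<open>\<Lambda> \<otimes> h\<close>. It sends \<open>h \<Lambda>\<^sub>1 \<otimes> S(\<Lambda>\<^sub>2)\<close> to \<open>h\<^sub>1 y \<otimes> z\<close> with
  \<open>y \<otimes> z = c(h\<^sub>2 \<otimes> \<Lambda>) = \<Lambda> \<otimes> h\<^sub>2\<close>, which is \<open>\<Lambda> \<otimes> h\<close> as well. Comparing images avoids any formula for
  the antipode of a product.
\<close>

lemma maschke_casimir: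
  assumes "integral \<Lambda>" and transparent: "\<And>h. c (h \<otimes> \<Lambda>) = \<Lambda> \<otimes> h"
  shows "sw (\<Delta> \<Lambda>) (\<lambda>p q. mul h p \<otimes> S q) = sw (\<Delta> \<Lambda>) (\<lambda>p q. p \<otimes> mul (S q) h)" (is "?L = ?R")
proof -
  define T where "T t = sw t (\<lambda>p q. sw (\<Delta> p) (\<lambda>p1 p2. p1 \<otimes> mul p2 q))" for t :: "'x \<times> 'x \<Rightarrow>\<^sub>0 'k"
  define T' where "T' t = sw t (\<lambda>p q. sw (\<Delta> p) (\<lambda>p1 p2. p1 \<otimes> mul (S p2) q))" for t :: "'x \<times> 'x \<Rightarrow>\<^sub>0 'k"
  have lT: "lin T" "lin T'" unfolding T_def T'_def by (simp_all add: lin_facts)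
  have T: "T (p \<otimes> q) = sw (\<Delta> p) (\<lambda>p1 p2. p1 \<otimes> mul p2 q)"
    and T': "T' (p \<otimes> q) = sw (\<Delta> p) (\<lambda>p1 p2. p1 \<otimes> mul (S p2) q)" for p q
    unfolding T_def T'_def by (simp_all add: sw_tensor lin_facts)
  have "T' (T (p \<otimes> q)) = p \<otimes> q" for p q
  proof -
    have "T' (T (p \<otimes> q)) = sw (\<Delta> p) (\<lambda>w r. sw (\<Delta> w) (\<lambda>a b. a \<otimes> mul (mul (S b) r) q))"
      by (simp add: T T' lin_sw[OF lT(2)] mul_assoc)
    also have "\<dots> = sw (\<Delta> p) (\<lambda>a w. sw (\<Delta> w) (\<lambda>b r. a \<otimes> mul (mul (S b) r) q))"
      by (rule coassoc)
    also have "\<dots> = sw (\<Delta> p) (\<lambda>a w. a \<otimes> mul (sw (\<Delta> w) (\<lambda>b r. mul (S b) r)) q)"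
      by (simp add: lin_sw[OF linear_tensor_right] lin_sw[OF mul_l])
    also have "\<dots> = sw (\<Delta> p) (\<lambda>a w. scl (\<epsilon> w) a \<otimes> q)"
      by (simp add: S_left lin_scl[OF linear_tensor_right] lin_scl[OF linear_tensor_left] lin_scl[OF mul_l] mul_one_left)
    also have "\<dots> = p \<otimes> q"
      by (simp add: lin_sw[OF linear_tensor_left, symmetric] counit_right)
    finally show ?thesis .
  qed
  then have inv: "T' (T t) = t" for t
    by (rule lin_eq_tensor[OF lin_comp[OF lT(2,1)] lin_id])
  have "T ?R = sw (\<Delta> \<Lambda>) (\<lambda>w r. sw (\<Delta> w) (\<lambda>p q. p \<otimes> mul (mul q (S r)) h))"
    by (simp add: lin_sw[OF lT(1)] T mul_assoc)
  also have "\<dots> = sw (\<Delta> \<Lambda>) (\<lambda>p w. sw (\<Delta> w) (\<lambda>q r. p \<otimes> mul (mul q (S r)) h))"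
    by (rule coassoc)
  also have "\<dots> = sw (\<Delta> \<Lambda>) (\<lambda>p w. p \<otimes> mul (sw (\<Delta> w) (\<lambda>q r. mul q (S r))) h)"
    by (simp add: lin_sw[OF linear_tensor_right] lin_sw[OF mul_l])
  also have "\<dots> = sw (\<Delta> \<Lambda>) (\<lambda>p w. scl (\<epsilon> w) p \<otimes> h)"
    by (simp add: S_right lin_scl[OF linear_tensor_right] lin_scl[OF linear_tensor_left] lin_scl[OF mul_l] mul_one_left)
  also have "\<dots> = \<Lambda> \<otimes> h"
    by (simp add: lin_sw[OF linear_tensor_left, symmetric] counit_right)
  finally have TR: "T ?R = \<Lambda> \<otimes> h" .
  define W where "W h1 h2 p = sw (c (h2 \<otimes> p)) (\<lambda>y z. mul h1 y \<otimes> z)" for h1 h2 p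
  have lW: "lin (W h1 h2)" for h1 h2 unfolding W_def by (simp add: lin_facts)
  have "T ?L = sw (\<Delta> \<Lambda>) (\<lambda>w r. sw (\<Delta> h) (\<lambda>h1 h2. sw (\<Delta> w) (\<lambda>p q.
      sw (c (h2 \<otimes> p)) (\<lambda>y z. mul h1 y \<otimes> mul z (mul q (S r))))))"
    by (simp add: lin_sw[OF lT(1)] T \<Delta>_mul sw_sw sw_tensor lin_facts mul_assoc)
  also have "\<dots> = sw (\<Delta> h) (\<lambda>h1 h2. sw (\<Delta> \<Lambda>) (\<lambda>w r. sw (\<Delta> w) (\<lambda>p q.
      sw (c (h2 \<otimes> p)) (\<lambda>y z. mul h1 y \<otimes> mul z (mul q (S r))))))"
    by (rule sw_swap)
  also have "\<dots> = sw (\<Delta> h) (\<lambda>h1 h2. sw (\<Delta> \<Lambda>) (\<lambda>p w. sw (\<Delta> w) (\<lambda>q r.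
      sw (c (h2 \<otimes> p)) (\<lambda>y z. mul h1 y \<otimes> mul z (mul q (S r))))))"
    by (simp only: coassoc)
  also have "\<dots> = sw (\<Delta> h) (\<lambda>h1 h2. sw (\<Delta> \<Lambda>) (\<lambda>p w. sw (c (h2 \<otimes> p)) (\<lambda>y z. 
      mul h1 y \<otimes> mul z (sw (\<Delta> w) (\<lambda>q r. mul q (S r))))))"
    by (subst sw_swap) (simp add: lin_sw[OF linear_tensor_right] lin_sw[OF mul_r])
  also have "\<dots> = sw (\<Delta> h) (\<lambda>h1 h2. sw (\<Delta> \<Lambda>) (\<lambda>p w. W h1 h2 (scl (\<epsilon> w) p)))"
    unfolding lin_scl[OF lW]
    by (simp add: S_right W_def lin_scl[OF mul_r] mul_one_right lin_scl[OF linear_tensor_right] sw_scl)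
  also have "\<dots> = sw (\<Delta> h) (\<lambda>h1 h2. W h1 h2 \<Lambda>)"
    by (simp add: lin_sw[OF lW, symmetric] counit_right)
  also have "\<dots> = sw (\<Delta> h) (\<lambda>h1 h2. \<Lambda> \<otimes> scl (\<epsilon> h1) h2)"
    using assms(1) by (simp add: W_def transparent sw_tensor lin_facts integral_def
        lin_scl[OF linear_tensor_right] lin_scl[OF linear_tensor_left])
  also have "\<dots> = \<Lambda> \<otimes> h"
    by (simp add: lin_sw[OF linear_tensor_right, symmetric] counit_left)
  finally have "T ?L = T ?R" using TR by simp
  then show ?thesis using inv by metis
qed

text \<open>The averaged projection is \<open>x \<mapsto> \<Lambda>\<^sub>1 \<pi>(S(\<Lambda>\<^sub>2) x)\<close>; its kernel is the complement.\<close>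

lemma maschke:
  assumes "integral \<Lambda>" and transparent: "\<And>h. c (h \<otimes> \<Lambda>) = \<Lambda> \<otimes> h" and "\<epsilon> \<Lambda> = 1"
    and I: "kvec.subspace I" "\<And>a x. x \<in> I \<Longrightarrow> mul a x \<in> I"
  obtains J where "kvec.subspace J" "\<And>a x. x \<in> J \<Longrightarrow> mul a x \<in> J" "I \<inter> J = {0}"
    "\<And>a. \<exists>x\<in>I. \<exists>y\<in>J. a = x + y"
proof -
  interpret vp: vector_space_pair "scl :: 'k \<Rightarrow> ('x \<Rightarrow>\<^sub>0 'k) \<Rightarrow> _" "scl :: 'k \<Rightarrow> ('x \<Rightarrow>\<^sub>0 'k) \<Rightarrow> _" ..
  obtain \<pi> where \<pi>: "lin \<pi>" "\<And>x. \<pi> x \<in> I" "\<And>x. x \<in> I \<Longrightarrow> \<pi> x = x"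
    using vp.linear_exists_left_inverse_on[OF lin_id I(1)] by (auto simp: image_subset_iff)
  define P where "P x = sw (\<Delta> \<Lambda>) (\<lambda>p q. mul p (\<pi> (mul (S q) x)))" for x
  have lP: "lin P" unfolding P_def by (simp add: lin_facts lin_comp[OF \<pi>(1)])
  have PI: "P x \<in> I" for x
    unfolding P_def sw_expand by (intro kvec.subspace_sum I(1) kvec.subspace_scale I(2) \<pi>(2))
  have Pid: "P x = x" if "x \<in> I" for x
  proof -
    have "P x = sw (\<Delta> \<Lambda>) (\<lambda>p q. mul (mul p (S q)) x)"
      using that by (simp add: P_def \<pi>(3) I(2) mul_assoc)
    also have "\<dots> = x"
      by (simp add: lin_sw[OF mul_l, symmetric] S_right assms(3) kvec.scale_one mul_one_left)
    finally show ?thesis .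
  qed
  have Pmul: "P (mul h x) = mul h (P x)" for h x
  proof -
    have "mul h (P x) = sw (sw (\<Delta> \<Lambda>) (\<lambda>p q. mul h p \<otimes> S q)) (\<lambda>u v. mul u (\<pi> (mul v x)))"
      by (simp add: P_def lin_sw[OF mul_r] sw_sw sw_tensor lin_facts lin_comp[OF \<pi>(1)] mul_assoc)
    also have "\<dots> = P (mul h x)"
      unfolding maschke_casimir[OF assms(1) transparent]
      by (simp add: P_def sw_sw sw_tensor lin_facts lin_comp[OF \<pi>(1)] mul_assoc)
    finally show ?thesis by simp
  qed
  show ?thesis
  proof (rule that[of "{x. P x = 0}"])
    show "kvec.subspace {x. P x = 0}"
      by (rule kvec.subspaceI) (auto simp: lin_0[OF lP] lin_add[OF lP] lin_scl[OF lP])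
    show "mul a x \<in> {x. P x = 0}" if "x \<in> {x. P x = 0}" for a x
      using that by (simp add: Pmul lin_0[OF mul_r])
    show "I \<inter> {x. P x = 0} = {0}"
      using Pid kvec.subspace_0[OF I(1)] by (auto simp: lin_0[OF lP])
    show "\<exists>x\<in>I. \<exists>y\<in>{x. P x = 0}. a = x + y" for a
      by (rule bexI[OF _ PI[of a]], rule bexI[of _ "a - P a"]) (auto simp: lin_diff[OF lP] Pid[OF PI])
  qed
qed

text \<open>
  The left integrals of the reversed structure are the right integrals of the given one. Rigidity is
  the only axiom that does not carry over to the braiding \<open>flip \<circ> c \<circ> flip\<close> by itself.
\<close>

lemma opposite:
  assumes "\<And>f h. lform f \<Longrightarrow> \<exists>ps. (\<forall>(g, k)\<in>set ps. lform g) \<and>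
      (\<forall>x. scl (f x) h = (\<Sum>(g, k)\<leftarrow>ps. kl g (flip (c (flip (k \<otimes> x))))))"
  shows "prebraided_hopf (\<lambda>a b. mul b a) un (\<lambda>a. flip (\<Delta> a)) \<epsilon> S (\<lambda>t. flip (c (flip t)))"
proof (rule prebraided_hopf.intro, goal_cases)
  \<comment> \<open>coassociativity\<close>
  case (9 a)
  have *: "assoc (flip t \<otimes> r) = sw t (\<lambda>p q. q \<otimes> p \<otimes> r)" for t :: "'x \<times> 'x \<Rightarrow>\<^sub>0 'k" and r :: "'x \<Rightarrow>\<^sub>0 'k"
    by (rule lin_eq_tensor[of "\<lambda>t. assoc (flip t \<otimes> r)"]) (simp_all add: assoc_tensor sw_tensor lin_rules)
  have "assoc (sw (flip (\<Delta> a)) (\<lambda>w r. flip (\<Delta> w) \<otimes> r)) =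
      sw (\<Delta> a) (\<lambda>r w. sw (\<Delta> w) (\<lambda>p q. q \<otimes> p \<otimes> r))"
    by (simp add: lin_sw[OF lin_assoc[OF lin_id]] *)
  also have "\<dots> = sw (\<Delta> a) (\<lambda>w p. sw (\<Delta> w) (\<lambda>r q. p \<otimes> q \<otimes> r))"
    by (rule coassoc[symmetric])
  also have "\<dots> = sw (flip (\<Delta> a)) (\<lambda>p w. p \<otimes> flip (\<Delta> w))"
    by (simp only: sw_flip, simp add: flip_eq_sw lin_sw[OF linear_tensor_right])
  finally show ?case .
next
  \<comment> \<open>comultiplication of a product\<close>
  case (16 a b)
  have "flip (\<Delta> (mul b a)) = sw (\<Delta> b) (\<lambda>b1 b2. sw (\<Delta> a) (\<lambda>a1 a2.
                  sw (c (b2 \<otimes> a1)) (\<lambda>y z. mul z a2 \<otimes> mul b1 y)))"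
    by (simp add: \<Delta>_mul lin_sw[OF lin_flip[OF lin_id]])
  also have "\<dots> = sw (\<Delta> a) (\<lambda>a1 a2. sw (\<Delta> b) (\<lambda>b1 b2.
                  sw (c (b2 \<otimes> a1)) (\<lambda>y z. mul z a2 \<otimes> mul b1 y)))"
    by (rule sw_swap)
  finally show ?case by simp
next
  \<comment> \<open>rigidity\<close>
  case (20 f h)
  then show ?case by (rule assms)
qed (simp_all add: fin lin_facts mul_assoc mul_one_left mul_one_right lform_\<epsilon> counit_left counit_right
    S_left S_right \<Delta>_one \<epsilon>_mul \<epsilon>_one)

end

section \<open>Elementwise form of the axioms\<close>

lemma is_algebraD:
  assumes "is_algebra A"
  shows "lin (mult A)"
    and "mult A (mult A (a \<otimes> b) \<otimes> d) = mult A (a \<otimes> mult A (b \<otimes> d))"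
    and "mult A (one A \<otimes> a) = a" "mult A (a \<otimes> one A) = a"
proof -
  show l: "lin (mult A)" "mult A (one A \<otimes> a) = a" "mult A (a \<otimes> one A) = a"
    using assms by (auto simp: is_algebra_def)
  have "(mult A \<circ> (mult A \<otimes>\<^sub>m id)) ((a \<otimes> b) \<otimes> d) = (mult A \<circ> (id \<otimes>\<^sub>m mult A) \<circ> assoc) ((a \<otimes> b) \<otimes> d)"
    using assms by (simp only: is_algebra_def)
  then show "mult A (mult A (a \<otimes> b) \<otimes> d) = mult A (a \<otimes> mult A (b \<otimes> d))"
    using l by (simp add: tmap_tensor lin_id' assoc_tensor)
qed

lemma is_coalgebraD:
  assumes "is_coalgebra A"
  shows "lin (comult A)" "lform (counit A)"
    and "assoc (sw (comult A a) (\<lambda>w r. comult A w \<otimes> r)) = sw (comult A a) (\<lambda>p w. p \<otimes> comult A w)"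
    and "sw (comult A a) (\<lambda>p q. scl (counit A p) q) = a"
    and "sw (comult A a) (\<lambda>p q. scl (counit A q) p) = a"
proof -
  show "lin (comult A)" "lform (counit A)"
    using assms by (auto simp: is_coalgebra_def)
  have "(assoc \<circ> (comult A \<otimes>\<^sub>m id) \<circ> comult A) a = ((id \<otimes>\<^sub>m comult A) \<circ> comult A) a"
    "(kl (counit A) \<circ> comult A) a = id a" "(kr (counit A) \<circ> comult A) a = id a"
    using assms by (simp_all only: is_coalgebra_def)
  then show "assoc (sw (comult A a) (\<lambda>w r. comult A w \<otimes> r)) = sw (comult A a) (\<lambda>p w. p \<otimes> comult A w)"
    "sw (comult A a) (\<lambda>p q. scl (counit A p) q) = a"
    "sw (comult A a) (\<lambda>p q. scl (counit A q) p) = a"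
    by (simp_all add: tmap_sw kl_def kr_def)
qed

lemma is_antipodeD:
  assumes "is_antipode A S" and al: "is_algebra A"
  shows "lin S"
    and "sw (comult A a) (\<lambda>p q. mult A (S p \<otimes> q)) = scl (counit A a) (one A)" (is ?l)
    and "sw (comult A a) (\<lambda>p q. mult A (p \<otimes> S q)) = scl (counit A a) (one A)" (is ?r)
proof -
  show "lin S" using assms by (auto simp: is_antipode_def)
  have "(mult A \<circ> (S \<otimes>\<^sub>m id) \<circ> comult A) a = scl (counit A a) (one A)"
    "(mult A \<circ> (id \<otimes>\<^sub>m S) \<circ> comult A) a = scl (counit A a) (one A)"
    using assms by (simp_all only: is_antipode_def)
  then show ?l ?r
    by (simp_all add: tmap_sw lin_sw[OF is_algebraD(1)[OF al]])
qed

lemma left_moduleD: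
  assumes "left_module A \<alpha>"
  shows "lin \<alpha>" "\<alpha> (one A \<otimes> v) = v"
    and "is_algebra A \<Longrightarrow> \<alpha> (mult A (a \<otimes> b) \<otimes> v) = \<alpha> (a \<otimes> \<alpha> (b \<otimes> v))"
proof -
  show l: "lin \<alpha>" "\<alpha> (one A \<otimes> v) = v" using assms by (auto simp: left_module_def)
  assume "is_algebra A"
  then have m: "lin (mult A)" by (rule is_algebraD)
  have "(\<alpha> \<circ> (mult A \<otimes>\<^sub>m id)) ((a \<otimes> b) \<otimes> v) = (\<alpha> \<circ> (id \<otimes>\<^sub>m \<alpha>) \<circ> assoc) ((a \<otimes> b) \<otimes> v)"
    using assms by (simp only: left_module_def)
  then show "\<alpha> (mult A (a \<otimes> b) \<otimes> v) = \<alpha> (a \<otimes> \<alpha> (b \<otimes> v))"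
    using l m by (simp add: tmap_tensor lin_id' assoc_tensor)
qed

lemma left_comoduleD:
  assumes "left_comodule A \<phi>"
  shows "lin \<phi>"
    and "assoc (sw (\<phi> v) (\<lambda>w r. comult A w \<otimes> r)) = sw (\<phi> v) (\<lambda>p w. p \<otimes> \<phi> w)"
    and "sw (\<phi> v) (\<lambda>p q. scl (counit A p) q) = v"
proof -
  show "lin \<phi>" using assms by (auto simp: left_comodule_def)
  have "(assoc \<circ> (comult A \<otimes>\<^sub>m id) \<circ> \<phi>) v = ((id \<otimes>\<^sub>m \<phi>) \<circ> \<phi>) v" "(kl (counit A) \<circ> \<phi>) v = id v"
    using assms by (simp_all only: left_comodule_def)
  then show "assoc (sw (\<phi> v) (\<lambda>w r. comult A w \<otimes> r)) = sw (\<phi> v) (\<lambda>p w. p \<otimes> \<phi> w)"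
    "sw (\<phi> v) (\<lambda>p q. scl (counit A p) q) = v"
    by (simp_all add: tmap_sw kl_def)
qed

lemma braiding_tensor:
  assumes "lin (coact V)" "lin (act W)"
  shows "braiding V W (v \<otimes> w) = sw (coact V v) (\<lambda>b v0. act W (b \<otimes> w) \<otimes> v0)"
proof -
  have "(act W \<otimes>\<^sub>m id) (flip23 (t \<otimes> w)) = sw t (\<lambda>b v0. act W (b \<otimes> w) \<otimes> v0)" for t
    by (rule lin_eq_tensor[of "\<lambda>t. (act W \<otimes>\<^sub>m id) (flip23 (t \<otimes> w))"])
      (simp_all add: lin_rules flip23_tensor tmap_tensor assms(2) lin_id' sw_tensor lin_comp[OF assms(2)])
  then show ?thesis
    by (simp add: braiding_def tmap_tensor assms(1) lin_id')
qed

lemma comult_multD: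
  assumes "comult A \<circ> mult A = (mult A \<otimes>\<^sub>m mult A) \<circ> inner c \<circ> (comult A \<otimes>\<^sub>m comult A)"
    and "lin c" "lin (mult A)" "lin (comult A)"
  shows "comult A (mult A (a \<otimes> b)) = sw (comult A a) (\<lambda>a1 a2. sw (comult A b) (\<lambda>b1 b2.
                  sw (c (a2 \<otimes> b1)) (\<lambda>y z. mult A (a1 \<otimes> y) \<otimes> mult A (z \<otimes> b2))))"
proof -
  have "(comult A \<circ> mult A) (a \<otimes> b) = ((mult A \<otimes>\<^sub>m mult A) \<circ> inner c \<circ> (comult A \<otimes>\<^sub>m comult A)) (a \<otimes> b)"
    by (simp only: assms(1))
  then show ?thesis
    using assms(2-) by (simp add: tmap_tensor inner_sw lin_sw[OF lin_tmap[OF lin_id]])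
qed

lemma yd_tensor_act:
  assumes "lin (comult B)" "lin (act V)" "lin (act W)"
  shows "act (yd_tensor B V W) (b \<otimes> v \<otimes> w) = sw (comult B b) (\<lambda>b1 b2. act V (b1 \<otimes> v) \<otimes> act W (b2 \<otimes> w))"
proof -
  have "inner flip (t \<otimes> v \<otimes> w) = sw t (\<lambda>b1 b2. (b1 \<otimes> v) \<otimes> b2 \<otimes> w)" for t :: "'b \<times> 'b \<Rightarrow>\<^sub>0 'a"
    by (rule lin_eq_tensor[of "\<lambda>t. inner flip (t \<otimes> v \<otimes> w)"])
      (simp_all add: lin_rules inner_tensor lin_flip[OF lin_id] sw_tensor)
  then show ?thesis
    using assms by (simp add: yd_tensor_def tmap_tensor lin_id' lin_sw[OF lin_tmap[OF lin_id]])
qed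

text \<open>Apply the counit to \<open>S(a\<^sub>1) a\<^sub>2 = \<epsilon>(a) 1\<close>.\<close>

lemma antipode_counit:
  assumes "is_bialgebra c A" "is_antipode A S"
  shows "counit A (S a) = counit A a"
proof -
  have al: "is_algebra A" and co: "is_coalgebra A"
    and m: "\<And>a b. counit A (mult A (a \<otimes> b)) = counit A a * counit A b" and u: "counit A (one A) = 1"
    using assms(1) by (auto simp: is_bialgebra_def)
  note e = is_coalgebraD(2)[OF co] and S = is_antipodeD[OF assms(2) al]
  have "scl (counit A a) (one A) = scl (counit A (sw (comult A a) (\<lambda>p q. mult A (S p \<otimes> q)))) (one A)"
    by (simp add: S(2) lform_scl[OF e] u)
  also have "\<dots> = sw (comult A a) (\<lambda>p q. scl (counit A (S (scl (counit A q) p))) (one A))"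
    by (simp add: lin_sw[OF lin_scl_left[OF e]] m lin_scl[OF S(1)] lform_scl[OF e] mult.commute)
  also have "\<dots> = scl (counit A (S a)) (one A)"
    by (subst lin_sw[OF lin_scl_left[OF lform_comp[OF e S(1)]], symmetric])
      (simp add: is_coalgebraD(5)[OF co])
  finally have "counit A (scl (counit A a) (one A)) = counit A (scl (counit A (S a)) (one A))" by (rule arg_cong)
  then show ?thesis by (simp add: lform_scl[OF e] u)
qed

lemma fin_dim_finite:
  assumes "fin_dim (A :: ('b, 'x, 'k::field) braided)"
  shows "finite (UNIV :: 'x set)"
proof -
  from assms obtain X :: "('x \<Rightarrow>\<^sub>0 'k) set" where X: "finite X" "kvec.span X = UNIV"
    by (auto simp: fin_dim_def)
  let ?U = "\<Union>p\<in>X. supp p"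
  have "kvec.span X \<subseteq> {p. supp p \<subseteq> ?U}"
  proof (rule kvec.span_minimal)
    show "kvec.subspace {p :: 'x \<Rightarrow>\<^sub>0 'k. supp p \<subseteq> ?U}"
    proof (rule kvec.subspaceI)
      show "x + y \<in> {p. supp p \<subseteq> ?U}" if "x \<in> {p. supp p \<subseteq> ?U}" "y \<in> {p. supp p \<subseteq> ?U}" for x y
        using that keys_add[of x y] by blast
      show "scl c x \<in> {p. supp p \<subseteq> ?U}" if "x \<in> {p. supp p \<subseteq> ?U}" for c x
      proof -
        have "supp (scl c x) \<subseteq> supp x" by (auto simp: in_keys_iff)
        with that show ?thesis by blast
      qed
    qed simp
  qed auto
  then have "supp (bvec x :: 'x \<Rightarrow>\<^sub>0 'k) \<subseteq> ?U" for x using X(2) by blast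
  then have "UNIV \<subseteq> ?U" by auto
  then show ?thesis using X(1) by (meson finite_UN finite_keys finite_subset)
qed

section \<open>Integrals in the Yetter--Drinfeld category\<close>

text \<open>Lets the witnesses for rigidity be given by a Sweedler sum.\<close>

lemma sw_rigid:
  assumes "\<And>b. lform (g b)" and "\<And>x. scl (f x) h = sw t (\<lambda>b y. kl (g b) (c (k y \<otimes> x)))"
  shows "\<exists>ps. (\<forall>(g, k)\<in>set ps. lform g) \<and> (\<forall>x. scl (f x) h = (\<Sum>(g, k)\<leftarrow>ps. kl g (c (k \<otimes> x))))"
proof -
  obtain xs where xs: "set xs = supp t" "distinct xs" using finite_distinct_list[of "supp t"] by auto
  define ps where "ps = map (\<lambda>z. (\<lambda>v. coef t z * g (bvec (fst z)) v, k (bvec (snd z)))) xs"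
  have "lform (\<lambda>v. a * g b v)" for a b
    by (rule lformI) (simp_all add: lform_add[OF assms(1)] lform_scl[OF assms(1)] algebra_simps)
  then have "\<forall>(g, k)\<in>set ps. lform g" by (auto simp: ps_def)
  moreover have "scl (f x) h = (\<Sum>(g, k)\<leftarrow>ps. kl g (c (k \<otimes> x)))" for x
  proof -
    have kl: "kl (\<lambda>v. a * g b v) w = scl a (kl (g b) w)" for a b w
      unfolding kl_def kvec.scale_scale[symmetric] sw_scl ..
    have "scl (f x) h = (\<Sum>z\<leftarrow>xs. scl (coef t z) (kl (g (bvec (fst z))) (c (k (bvec (snd z)) \<otimes> x))))"
      unfolding assms(2) sw_expand[where t = t] using xs by (simp add: sum_list_distinct_conv_sum_set)
    also have "\<dots> = (\<Sum>(g, k)\<leftarrow>ps. kl g (c (k \<otimes> x)))"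
      by (simp add: ps_def kl o_def)
    finally show ?thesis .
  qed
  ultimately show ?thesis by blast
qed

locale fin_braided_hopf =
  fixes B :: "('b, 'k::field) bialg" and A :: "('b, 'x, 'k) braided"
    and SB :: "('b \<Rightarrow>\<^sub>0 'k) \<Rightarrow> ('b \<Rightarrow>\<^sub>0 'k)" and S :: "('x \<Rightarrow>\<^sub>0 'k) \<Rightarrow> ('x \<Rightarrow>\<^sub>0 'k)"
  assumes B: "is_bialgebra flip B" "is_antipode B SB"
    and A: "braided_bialgebra B A" "is_antipode A S" and fin: "fin_dim A"
begin

abbreviation ac where "ac b v \<equiv> act (yd_str A) (b \<otimes> v)"
abbreviation rho where "rho \<equiv> coact (yd_str A)"
abbreviation br where "br \<equiv> braiding (yd_str A) (yd_str A)"
abbreviation mu where "mu a b \<equiv> mult A (a \<otimes> b)"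

lemma B': "is_algebra B" "is_coalgebra B" and A': "is_algebra A" "is_coalgebra A"
  and mod: "left_module B (act (yd_str A))" and comod: "left_comodule B (coact (yd_str A))"
  using B(1) A(1) by (auto simp: is_bialgebra_def braided_bialgebra_def yd_module_def)

lemmas mB = is_algebraD[OF B'(1)] and dB = is_coalgebraD[OF B'(2)] and SB = is_antipodeD[OF B(2) B'(1)]
  and mA = is_algebraD[OF A'(1)] and dA = is_coalgebraD[OF A'(2)] and SA = is_antipodeD[OF A(2) A'(1)]
  and lac = left_moduleD(1)[OF mod] and ac_one = left_moduleD(2)[OF mod]
  and ac_mult = left_moduleD(3)[OF mod B'(1)] and lrho = left_comoduleD(1)[OF comod]
  and rho_counit = left_comoduleD(3)[OF comod]

lemmas coassocB = coassoc_sw[OF dB(3)] and rho_assoc = coassoc_sw[OF left_comoduleD(2)[OF comod]]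

lemmas lin_facts = lin_rules mB(1) lin_comp[OF mB(1)] dB(1) lin_comp[OF dB(1)] SB(1) lin_comp[OF SB(1)]
  mA(1) lin_comp[OF mA(1)] dA(1) lin_comp[OF dA(1)] SA(1) lin_comp[OF SA(1)]
  lac lin_comp[OF lac] lrho lin_comp[OF lrho] lin_scl_left[OF dB(2)] lin_scl_left[OF lform_comp[OF dB(2)]]
  lin_scl_left[OF dA(2)] lin_scl_left[OF lform_comp[OF dA(2)]]

lemma br_tensor: "br (v \<otimes> w) = sw (rho v) (\<lambda>b v0. ac b w \<otimes> v0)"
  by (rule braiding_tensor[OF lrho lac])

lemma lin_br: "lin br"
  unfolding braiding_def o_def by (intro lin_rules lin_comp[OF lin_tmap[OF lin_id]])

text \<open>
  Here \<open>(f \<otimes> id)(c(k \<otimes> x)) = f(k\<^sub>-\<^sub>1 x) k\<^sub>0\<close>. Taking the forms \<open>x \<mapsto> f(S(h\<^sub>-\<^sub>1) x)\<close> with the vectors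
  \<open>h\<^sub>0\<close> produces \<open>S(h\<^sub>-\<^sub>2) h\<^sub>-\<^sub>1\<close>, which cancels.
\<close>

lemma rigid_left:
  assumes f: "lform f"
  shows "\<exists>ps. (\<forall>(g, k)\<in>set ps. lform g) \<and> (\<forall>x. scl (f x) h = (\<Sum>(g, k)\<leftarrow>ps. kl g (br (k \<otimes> x))))"
proof (rule sw_rigid)
  show g: "lform (\<lambda>x. f (ac (SB b) x))" for b
    by (rule lform_comp[OF f]) (simp add: lin_facts)
  fix x
  define F where "F b y = scl (f (ac b x)) y" for b and y :: "'x \<Rightarrow>\<^sub>0 'k"
  have F: "lin (\<lambda>b. F b y)" "lin (F b)" for b y
    unfolding F_def by (intro lin_scl_left lin_scl_right lform_comp[OF f] lin_id; simp add: lin_facts)+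
  have "sw (rho h) (\<lambda>b y. kl (\<lambda>x. f (ac (SB b) x)) (br (y \<otimes> x))) =
      sw (rho h) (\<lambda>b y. sw (rho y) (\<lambda>b' y0. F (mult B (SB b \<otimes> b')) y0))"
    by (simp add: br_tensor lin_sw[OF lin_kl[OF lin_id]] kl_tensor[OF g] ac_mult F_def)
  also have "\<dots> = sw (rho h) (\<lambda>w y. sw (comult B w) (\<lambda>b b'. F (mult B (SB b \<otimes> b')) y))"
    by (rule rho_assoc[symmetric])
  also have "\<dots> = sw (rho h) (\<lambda>w y. F (one B) (scl (counit B w) y))"
    by (simp add: lin_sw[OF F(1), symmetric] SB(2) lin_scl[OF F(1)] lin_scl[OF F(2)])
  also have "\<dots> = F (one B) h"
    by (simp add: lin_sw[OF F(2), symmetric] rho_counit)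
  finally show "scl (f x) h = sw (rho h) (\<lambda>b y. kl (\<lambda>x. f (ac (SB b) x)) (br (y \<otimes> x)))"
    by (simp add: F_def ac_one)
qed

lemma flip_br: "flip (br (w \<otimes> v)) = sw (rho w) (\<lambda>b w0. w0 \<otimes> ac b v)"
  by (simp add: br_tensor lin_sw[OF lin_flip[OF lin_id]])

text \<open>
  For the reversed braiding \<open>(f \<otimes> id)(c'(k \<otimes> x)) = f(x\<^sub>0) x\<^sub>-\<^sub>1 k\<close>, so the coaction of the argument \<open>x\<close>
  has to be moved to the form: the forms are the coordinates of \<open>x \<mapsto> f(x\<^sub>0) x\<^sub>-\<^sub>1\<close> at the basis vectors
  \<open>b\<close> of \<open>B\<close>, with the vectors \<open>S(b) h\<close>, and \<open>x\<^sub>-\<^sub>2 S(x\<^sub>-\<^sub>1)\<close> cancels.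
\<close>

lemma rigid_right:
  assumes f: "lform f"
  shows "\<exists>ps. (\<forall>(g, k)\<in>set ps. lform g) \<and>
    (\<forall>x. scl (f x) h = (\<Sum>(g, k)\<leftarrow>ps. kl g (flip (br (flip (k \<otimes> x))))))"
proof -
  define G where "G x = kr f (rho x)" for x
  have lG: "lin G" unfolding G_def kr_def by (simp add: lin_facts)
  \<comment> \<open>Finitely many coordinates of \<open>B\<close> suffice because \<open>A\<close> is finite-dimensional.\<close>
  define U where "U = (\<Union>y. supp (G (bvec y)))"
  have "finite U" using fin_dim_finite[OF fin] by (simp add: U_def)
  then obtain xs where xs: "set xs = U" "distinct xs" using finite_distinct_list by auto
  define g where "g b x = coef (G x) b" for b x
  define k where "k b = ac (SB (bvec b)) h" for b
  have g: "lform (g b)" for b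
    unfolding g_def by (rule lform_comp[OF lform_coef lG])
  define F where "F b y = scl (f y) (ac b h)" for b y
  have F: "lin (\<lambda>b. F b y)" "lin (F b)" for b y
    unfolding F_def by (intro lin_scl_right lin_scl_left f; simp add: lin_facts)+
  have "scl (f x) h = (\<Sum>b\<leftarrow>xs. kl (g b) (flip (br (flip (k b \<otimes> x)))))" for x
  proof -
    have "(\<Sum>b\<leftarrow>xs. kl (g b) (flip (br (flip (k b \<otimes> x))))) =
        (\<Sum>b\<in>U. sw (rho x) (\<lambda>b' x0. scl (g b x0) (ac b' (k b))))"
      using xs by (simp add: sum_list_distinct_conv_sum_set flip_br lin_sw[OF lin_kl[OF lin_id]] kl_tensor[OF g])
    also have "\<dots> = sw (rho x) (\<lambda>b' x0. \<Sum>b\<in>U. scl (g b x0) (ac b' (k b)))"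
      by (rule sw_sum[symmetric])
    also have "\<dots> = sw (rho x) (\<lambda>b' x0. ac b' (ac (SB (G x0)) h))"
    proof (rule sw_cong)
      fix b' y
      have *: "lin (\<lambda>v. ac (bvec b') (ac (SB v) h))" by (simp add: lin_facts)
      have "G (bvec y) = (\<Sum>b\<in>U. scl (g b (bvec y)) (bvec b))"
        unfolding g_def using \<open>finite U\<close>
        by (subst bvec_expansion, intro sum.mono_neutral_left) (auto simp: U_def in_keys_iff)
      then show "(\<Sum>b\<in>U. scl (g b (bvec y)) (ac (bvec b') (k b))) = ac (bvec b') (ac (SB (G (bvec y))) h)"
        by (simp add: k_def lin_sum[OF *] lin_scl[OF *])
    qed
    also have "\<dots> = sw (rho x) (\<lambda>b' x0. sw (rho x0) (\<lambda>b y. F (mult B (b' \<otimes> SB b)) y))"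
    proof (rule sw_cong)
      fix b' y
      have *: "lin (\<lambda>v. ac (bvec b') (ac (SB v) h))" by (simp add: lin_facts)
      show "ac (bvec b') (ac (SB (G (bvec y))) h) = sw (rho (bvec y)) (\<lambda>b y. F (mult B (bvec b' \<otimes> SB b)) y)"
        by (simp add: G_def kr_def lin_sw[OF *] lin_scl[OF *] F_def ac_mult)
    qed
    also have "\<dots> = sw (rho x) (\<lambda>w y. sw (comult B w) (\<lambda>b' b. F (mult B (b' \<otimes> SB b)) y))"
      by (rule rho_assoc[symmetric])
    also have "\<dots> = sw (rho x) (\<lambda>w y. F (one B) (scl (counit B w) y))"
      by (simp add: lin_sw[OF F(1), symmetric] SB(3) lin_scl[OF F(1)] lin_scl[OF F(2)])
    also have "\<dots> = F (one B) x"
      by (simp add: lin_sw[OF F(2), symmetric] rho_counit)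
    finally show ?thesis by (simp add: F_def ac_one)
  qed
  then show ?thesis
    by (intro exI[of _ "map (\<lambda>b. (g b, k b)) xs"]) (auto simp: g o_def)
qed

sublocale left: prebraided_hopf mu "one A" "comult A" "counit A" S br
proof (rule prebraided_hopf.intro, goal_cases)
  \<comment> \<open>comultiplication of a product\<close>
  case (16 a b)
  have "comult A \<circ> mult A = (mult A \<otimes>\<^sub>m mult A) \<circ> inner br \<circ> (comult A \<otimes>\<^sub>m comult A)"
    using A(1) by (simp only: braided_bialgebra_def is_bialgebra_def)
  then show ?case by (rule comult_multD[OF _ lin_br mA(1) dA(1)])
next
  \<comment> \<open>rigidity\<close>
  case (20 f h)
  then show ?case by (rule rigid_left)
qed (use A(1) in \<open>simp_all add: fin_dim_finite[OF fin] lin_facts lin_br mA dA SA braided_bialgebra_def is_bialgebra_def\<close>)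

sublocale right: prebraided_hopf "\<lambda>a b. mu b a" "one A" "\<lambda>a. flip (comult A a)" "counit A" S
  "\<lambda>t. flip (br (flip t))"
  by (rule left.opposite[OF rigid_right])

lemma left_integral_unique:
  assumes "left_integral A \<Lambda>" "\<Lambda> \<noteq> 0" "left_integral A \<Lambda>'"
  obtains d where "\<Lambda>' = scl d \<Lambda>"
  using left.integral_unique[of \<Lambda> \<Lambda>'] assms by (auto simp: left_integral_def left.integral_def)

lemma right_integral_unique:
  assumes "right_integral A \<Lambda>" "\<Lambda> \<noteq> 0" "right_integral A \<Lambda>'"
  obtains d where "\<Lambda>' = scl d \<Lambda>"
  using right.integral_unique[of \<Lambda> \<Lambda>'] assms by (auto simp: right_integral_def right.integral_def)

text \<open>
  The product \<open>\<Lambda> h\<close> is again a left integral, hence a multiple of \<open>\<Lambda>\<close>, and the counit identifies the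
  factor as \<open>\<epsilon>(h)\<close>.
\<close>

lemma left_imp_right_integral:
  assumes "left_integral A \<Lambda>" "counit A \<Lambda> \<noteq> 0"
  shows "right_integral A \<Lambda>"
  unfolding right_integral_def
proof
  fix h
  have "left_integral A (mu \<Lambda> h)"
    using assms(1) by (simp add: left_integral_def left.mul_assoc[symmetric] lin_scl[OF left.mul_l])
  moreover have "\<Lambda> \<noteq> 0" using assms(2) lform_0[OF dA(2)] by auto
  ultimately obtain d where d: "mu \<Lambda> h = scl d \<Lambda>" using left_integral_unique assms(1) by metis
  then have "counit A \<Lambda> * counit A h = d * counit A \<Lambda>"
    by (metis left.\<epsilon>_mul lform_scl[OF dA(2)])
  with d assms(2) show "mu \<Lambda> h = scl (counit A h) \<Lambda>" by simp
qed

lemma right_imp_left_integral: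
  assumes "right_integral A \<Lambda>" "counit A \<Lambda> \<noteq> 0"
  shows "left_integral A \<Lambda>"
  unfolding left_integral_def
proof
  fix h
  have "right_integral A (mu h \<Lambda>)"
    using assms(1) by (simp add: right_integral_def left.mul_assoc lin_scl[OF left.mul_r])
  moreover have "\<Lambda> \<noteq> 0" using assms(2) lform_0[OF dA(2)] by auto
  ultimately obtain d where d: "mu h \<Lambda> = scl d \<Lambda>" using right_integral_unique assms(1) by metis
  then have "counit A h * counit A \<Lambda> = d * counit A \<Lambda>"
    by (metis left.\<epsilon>_mul lform_scl[OF dA(2)])
  with d assms(2) show "mu h \<Lambda> = scl (counit A h) \<Lambda>" by simp
qed

lemma ac_mu: "ac b (mu x y) = sw (comult B b) (\<lambda>b1 b2. mu (ac b1 x) (ac b2 y))"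
proof -
  have "(mult A \<circ> act (yd_tensor B (yd_str A) (yd_str A))) (b \<otimes> x \<otimes> y) = (act (yd_str A) \<circ> (id \<otimes>\<^sub>m mult A)) (b \<otimes> x \<otimes> y)"
    using A(1) by (simp only: braided_bialgebra_def yd_hom_def)
  then show ?thesis
    by (simp add: yd_tensor_act dB(1) lac lin_sw[OF mA(1)] tmap_tensor lin_id' mA(1))
qed

lemma counit_ac: "counit A (ac b a) = counit B b * counit A a"
  using A(1) by (simp add: braided_bialgebra_def)

text \<open>
  The computation is \<open>(b \<Lambda>) h = (b\<^sub>1 \<Lambda>) (b\<^sub>2 S(b\<^sub>3) h) = b\<^sub>1 (\<Lambda> (S(b\<^sub>2) h)) = \<epsilon>(h) b \<Lambda>\<close>. For left
  integrals the order of the factors would call for the inverse of the antipode.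
\<close>

lemma right_integral_ac:
  assumes "right_integral A \<Lambda>"
  shows "right_integral A (ac b \<Lambda>)"
  unfolding right_integral_def
proof
  fix h
  have 1: "lin (\<lambda>b. mu (ac b \<Lambda>) h)" "lin (\<lambda>b. ac b h)" for h by (simp_all add: lin_facts)
  have 2: "lin (\<lambda>c. mu v (ac c h))" for v by (simp add: lin_facts)
  have "mu (ac b \<Lambda>) h = sw (comult B b) (\<lambda>b1 w. mu (ac (scl (counit B w) b1) \<Lambda>) h)"
    by (simp add: lin_sw[OF 1(1), symmetric] dB(5))
  also have "\<dots> = sw (comult B b) (\<lambda>b1 w. mu (ac b1 \<Lambda>) (ac (scl (counit B w) (one B)) h))"
    by (simp add: lin_scl[OF 1(1)] lin_scl[OF 2] ac_one)
  also have "\<dots> = sw (comult B b) (\<lambda>b1 w. sw (comult B w) (\<lambda>b2 b3. mu (ac b1 \<Lambda>) (ac b2 (ac (SB b3) h))))"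
    by (simp add: SB(3)[symmetric] lin_sw[OF 2] ac_mult)
  also have "\<dots> = sw (comult B b) (\<lambda>w b3. sw (comult B w) (\<lambda>b1 b2. mu (ac b1 \<Lambda>) (ac b2 (ac (SB b3) h))))"
    by (rule coassocB[symmetric])
  also have "\<dots> = sw (comult B b) (\<lambda>w b3. ac w (mu \<Lambda> (ac (SB b3) h)))"
    by (simp add: ac_mu)
  also have "\<dots> = sw (comult B b) (\<lambda>w b3. scl (counit A h) (ac (scl (counit B b3) w) \<Lambda>))"
  proof -
    have "ac w (scl d v) = scl d (ac w v)" "ac (scl d w) v = scl d (ac w v)" for w v d
      by (rule lin_scl, simp add: lin_facts)+
    then show ?thesis
      using assms by (simp add: right_integral_def counit_ac antipode_counit[OF B] kvec.scale_scale mult.commute)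
  qed
  also have "\<dots> = scl (counit A h) (ac b \<Lambda>)"
    by (simp add: sw_scl lin_sw[OF lin_comp[OF lac linear_tensor_left], symmetric] dB(5))
  finally show "mu (ac b \<Lambda>) h = scl (counit A h) (ac b \<Lambda>)" .
qed

lemma semisimple_if_left:
  assumes "left_integral A \<Lambda>" "counit A \<Lambda> \<noteq> 0"
  shows "semisimple A"
proof -
  define L where "L = scl (inverse (counit A \<Lambda>)) \<Lambda>"
  have L: "left_integral A L" "counit A L = 1"
    using assms by (simp_all add: L_def left_integral_def lin_scl[OF left.mul_r] kvec.scale_scale mult.commute lform_scl[OF dA(2)])
  then have R: "right_integral A L" by (auto intro: left_imp_right_integral)
  have "L \<noteq> 0" using L(2) lform_0[OF dA(2)] by auto
  \<comment> \<open>By uniqueness \<open>b L\<close> is a multiple of \<open>L\<close>; since \<open>\<epsilon>(L) = 1\<close>, the factor is \<open>\<epsilon>(b)\<close>.\<close>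
  have inv: "ac b L = scl (counit B b) L" for b
  proof -
    obtain d where d: "ac b L = scl d L"
      using right_integral_unique[OF R \<open>L \<noteq> 0\<close> right_integral_ac[OF R]] by metis
    then have "counit B b * counit A L = d * counit A L"
      by (metis counit_ac lform_scl[OF dA(2)])
    with d L(2) show ?thesis by simp
  qed
  have tr: "br (h \<otimes> L) = L \<otimes> h" for h
  proof -
    have "br (h \<otimes> L) = sw (rho h) (\<lambda>b h0. L \<otimes> scl (counit B b) h0)"
      by (simp add: br_tensor inv lin_scl[OF linear_tensor_left] lin_scl[OF linear_tensor_right])
    also have "\<dots> = L \<otimes> h"
      by (simp add: lin_sw[OF linear_tensor_right, symmetric] rho_counit)
    finally show ?thesis .
  qed
  show ?thesis
    unfolding semisimple_def
  proof (intro allI impI)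
    fix I assume I: "left_ideal A I"
    have "left.integral L" using L(1) by (simp add: left_integral_def left.integral_def)
    from left.maschke[OF this tr L(2)] I obtain J where "kvec.subspace J" "\<And>a x. x \<in> J \<Longrightarrow> mu a x \<in> J"
      "I \<inter> J = {0}" "\<And>a. \<exists>x\<in>I. \<exists>y\<in>J. a = x + y" unfolding left_ideal_def by metis
    then show "\<exists>J. left_ideal A J \<and> I \<inter> J = {0} \<and> (\<forall>a. \<exists>x\<in>I. \<exists>y\<in>J. a = x + y)"
      by (auto simp: left_ideal_def)
  qed
qed

text \<open>
  A complement \<open>J\<close> of the kernel of the counit contains an element \<open>y\<close> with \<open>\<epsilon>(y) = 1\<close>. Then
  \<open>h y - \<epsilon>(h) y\<close> lies in \<open>J\<close> and in the kernel, so it vanishes.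
\<close>

lemma semisimple_imp_left:
  assumes "semisimple A"
  obtains \<Lambda> where "left_integral A \<Lambda>" "counit A \<Lambda> \<noteq> 0"
proof -
  let ?I = "{a. counit A a = 0}"
  note e = dA(2)
  have "left_ideal A ?I"
    unfolding left_ideal_def
    by (auto intro!: kvec.subspaceI simp: left.\<epsilon>_mul lform_add[OF e] lform_scl[OF e] lform_0[OF e])
  with assms obtain J where J: "left_ideal A J" "?I \<inter> J = {0}" "\<forall>a. \<exists>x\<in>?I. \<exists>y\<in>J. a = x + y"
    unfolding semisimple_def by meson
  then obtain x y where xy: "counit A x = 0" "y \<in> J" "one A = x + y" by blast
  have y: "counit A y = 1" using xy left.\<epsilon>_one by (simp add: lform_add[OF e])
  have "mu h y = scl (counit A h) y" for h
  proof -
    have "mu h y - scl (counit A h) y \<in> J"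
      using J(1) xy(2) by (auto simp: left_ideal_def intro: kvec.subspace_diff kvec.subspace_scale)
    moreover have "mu h y - scl (counit A h) y \<in> ?I"
      by (simp add: lform_diff[OF e] lform_scl[OF e] left.\<epsilon>_mul)
    ultimately have "mu h y - scl (counit A h) y = 0" using J(2) by blast
    then show ?thesis by simp
  qed
  then show ?thesis using that[of y] y by (simp add: left_integral_def)
qed

text \<open>Evaluate \<open>\<Lambda> y\<close> in two ways for a left integral \<open>y\<close> with nonzero counit.\<close>

lemma semisimple_imp_counit_right:
  assumes "semisimple A" "right_integral A \<Lambda>" "\<Lambda> \<noteq> 0"
  shows "counit A \<Lambda> \<noteq> 0"
proof -
  obtain y where y: "left_integral A y" "counit A y \<noteq> 0" by (rule semisimple_imp_left[OF assms(1)])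
  have "scl (counit A \<Lambda>) y = scl (counit A y) \<Lambda>"
    using y(1) assms(2) unfolding left_integral_def right_integral_def by metis
  then show ?thesis using y(2) assms(3) by (metis kvec.scale_eq_0_iff)
qed

lemma semisimple_imp_counit_left:
  assumes "semisimple A" "left_integral A \<Lambda>" "\<Lambda> \<noteq> 0"
  shows "counit A \<Lambda> \<noteq> 0"
proof -
  obtain y where y: "left_integral A y" "counit A y \<noteq> 0" by (rule semisimple_imp_left[OF assms(1)])
  obtain d where "y = scl d \<Lambda>" using left_integral_unique[OF assms(2,3) y(1)] .
  then show ?thesis using y(2) by (auto simp: lform_scl[OF dA(2)])
qed

end

section \<open>The double bicrossproduct\<close>

text \<open>
  The field \<open>'k\<close> is embedded as \<open>unit \<Rightarrow>\<^sub>0 'k\<close>, so that equality of linear forms can be checked on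
  elementary tensors.
\<close>

lemma coef_kr: "coef (kr (\<lambda>q. coef q y) t) x = coef t (x, y)"
proof -
  have *: "kr (\<lambda>q. coef q y) (p \<otimes> q) = scl (coef q y) p" for p :: "'z \<Rightarrow>\<^sub>0 'k::field" and q
    unfolding kr_def by (rule sw_tensor) (simp_all add: lin_rules)
  have "lin (\<lambda>t. scl (coef (kr (\<lambda>q. coef q y) t) x) (bvec ()))" "lin (\<lambda>t. scl (coef t (x, y)) (bvec ()))"
    by (simp_all add: kr_def lin_rules)
  then have "scl (coef (kr (\<lambda>q. coef q y) t) x) (bvec ()) = scl (coef t (x, y)) (bvec ())"
    by (rule lin_eq_tensor) (simp add: * mult.commute)
  then have "coef (scl (coef (kr (\<lambda>q. coef q y) t) x) (bvec ())) () = coef (scl (coef t (x, y)) (bvec ())) ()"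
    by (rule arg_cong)
  then show ?thesis by simp
qed

lemma coef_kl: "coef (kl (\<lambda>p. coef p x) t) y = coef t (x, y)"
proof -
  have *: "kl (\<lambda>p. coef p x) (p \<otimes> q) = scl (coef p x) q" for p and q :: "'z \<Rightarrow>\<^sub>0 'k::field"
    unfolding kl_def by (rule sw_tensor) (simp_all add: lin_rules)
  have "lin (\<lambda>t. scl (coef (kl (\<lambda>p. coef p x) t) y) (bvec ()))" "lin (\<lambda>t. scl (coef t (x, y)) (bvec ()))"
    by (simp_all add: kl_def lin_rules)
  then have "scl (coef (kl (\<lambda>p. coef p x) t) y) (bvec ()) = scl (coef t (x, y)) (bvec ())"
    by (rule lin_eq_tensor) (simp add: *)
  then have "coef (scl (coef (kl (\<lambda>p. coef p x) t) y) (bvec ())) () = coef (scl (coef t (x, y)) (bvec ())) ()"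
    by (rule arg_cong)
  then show ?thesis by simp
qed

lemma tensor_if_slices_left:
  assumes "v \<noteq> 0" "\<And>y. \<exists>d. kr (\<lambda>q. coef q y) t = scl d v"
  shows "\<exists>u. t = v \<otimes> u"
proof -
  obtain x where x: "coef v x \<noteq> 0" using assms(1) by (metis lookup_zero poly_mapping_eqI)
  have "coef t (x', y) = coef (v \<otimes> scl (inverse (coef v x)) (kl (\<lambda>p. coef p x) t)) (x', y)" for x' y
  proof -
    obtain d where d: "kr (\<lambda>q. coef q y) t = scl d v" using assms(2) by blast
    have "coef t (x', y) = d * coef v x'" for x'
      by (metis d coef_kr lookup_scl)
    then show ?thesis using x by (simp add: coef_kl)
  qed
  then have "t = v \<otimes> scl (inverse (coef v x)) (kl (\<lambda>p. coef p x) t)"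
    by (intro poly_mapping_eqI) (metis surj_pair)
  then show ?thesis ..
qed

lemma tensor_if_slices_right:
  assumes "v \<noteq> 0" "\<And>x. \<exists>d. kl (\<lambda>p. coef p x) t = scl d v"
  shows "\<exists>u. t = u \<otimes> v"
proof -
  obtain y where y: "coef v y \<noteq> 0" using assms(1) by (metis lookup_zero poly_mapping_eqI)
  have "coef t (x, y') = coef (scl (inverse (coef v y)) (kr (\<lambda>q. coef q y) t) \<otimes> v) (x, y')" for x y'
  proof -
    obtain d where d: "kl (\<lambda>p. coef p x) t = scl d v" using assms(2) by blast
    have "coef t (x, y') = d * coef v y'" for y'
      by (metis d coef_kl lookup_scl)
    then show ?thesis using y by (simp add: coef_kr)
  qed
  then have "t = scl (inverse (coef v y)) (kr (\<lambda>q. coef q y) t) \<otimes> v"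
    by (intro poly_mapping_eqI) (metis surj_pair)
  then show ?thesis ..
qed

locale fin_double_bicross =
  A: fin_braided_hopf B A SB SA + H: fin_braided_hopf B H SB SH + D: fin_braided_hopf B D SB SD
  for B :: "('b, 'k::field) bialg" and A :: "('b, 'x, 'k) braided" and H :: "('b, 'y, 'k) braided"
    and D :: "('b, 'x \<times> 'y, 'k) braided" and SB SA SH SD +
  fixes \<alpha> :: "('y \<times> 'x \<Rightarrow>\<^sub>0 'k) \<Rightarrow> ('x \<Rightarrow>\<^sub>0 'k)" and \<beta> :: "('y \<times> 'x \<Rightarrow>\<^sub>0 'k) \<Rightarrow> ('y \<Rightarrow>\<^sub>0 'k)"
    and \<phi> :: "('x \<Rightarrow>\<^sub>0 'k) \<Rightarrow> ('y \<times> 'x \<Rightarrow>\<^sub>0 'k)" and \<psi> :: "('y \<Rightarrow>\<^sub>0 'k) \<Rightarrow> ('y \<times> 'x \<Rightarrow>\<^sub>0 'k)"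
  assumes data: "bicross_data B A H \<alpha> \<beta> \<phi> \<psi>" and D_def: "D = double_bicross B A H \<alpha> \<beta> \<phi> \<psi>"
begin

lemma lin_\<alpha>: "lin \<alpha>" and lin_\<beta>: "lin \<beta>"
  and \<alpha>_one: "\<alpha> (one H \<otimes> a) = a" and \<beta>_one: "\<beta> (h \<otimes> one A) = h"
  using data by (auto simp: bicross_data_def left_module_coalgebra_def right_module_coalgebra_def
      left_module_def right_module_def)

lemmas lin_facts = A.lin_facts H.lin_facts lin_\<alpha> lin_comp[OF lin_\<alpha>] lin_\<beta> lin_comp[OF lin_\<beta>]

abbreviation C where "C \<equiv> braiding (yd_str H) (yd_str A)"

lemma C_tensor: "C (h \<otimes> a) = sw (H.rho h) (\<lambda>b h0. A.ac b a \<otimes> h0)"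
  by (rule braiding_tensor[OF H.lrho A.lac])

lemma lin_C: "lin C"
  unfolding braiding_def o_def by (intro lin_rules lin_comp[OF lin_tmap[OF lin_id]])

lemma mult_D: "D.mu (a \<otimes> h) (b \<otimes> g) = sw (comult H h) (\<lambda>h1 h2. sw (comult A b) (\<lambda>b1 b2.
    sw (C (h2 \<otimes> b1)) (\<lambda>y z. A.mu a (\<alpha> (h1 \<otimes> y)) \<otimes> H.mu (\<beta> (z \<otimes> b2)) g)))"
proof -
  have li: "lin (inner f)" for f :: "('z1 \<times> 'z2 \<Rightarrow>\<^sub>0 'k) \<Rightarrow> ('z3 \<times> 'z4 \<Rightarrow>\<^sub>0 'k)"
    by (rule lin_inner[OF lin_id])
  have lt: "lin (f \<otimes>\<^sub>m g)" for f :: "('z1 \<Rightarrow>\<^sub>0 'k) \<Rightarrow> ('z2 \<Rightarrow>\<^sub>0 'k)" and g :: "('z3 \<Rightarrow>\<^sub>0 'k) \<Rightarrow> ('z4 \<Rightarrow>\<^sub>0 'k)"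
    by (rule lin_tmap[OF lin_id])
  have 1: "inner (comult H \<otimes>\<^sub>m comult A) ((a \<otimes> h) \<otimes> (b \<otimes> g)) = (a \<otimes> comult H h) \<otimes> (comult A b \<otimes> g)"
    by (simp add: inner_tensor lt tmap_tensor lin_facts sw_tensor)
  have 2: "inner (inner C) ((a \<otimes> comult H h) \<otimes> (comult A b \<otimes> g)) =
      sw (comult H h) (\<lambda>h1 h2. sw (comult A b) (\<lambda>b1 b2. sw (C (h2 \<otimes> b1)) (\<lambda>y z. 
       (a \<otimes> (h1 \<otimes> y)) \<otimes> ((z \<otimes> b2) \<otimes> g))))"
    by (simp add: inner_tensor[OF li] inner_sw[OF lin_C] sw_sw sw_tensor lin_facts)
  show ?thesis
    by (simp add: D_def double_bicross_def 1 2 lin_sw[OF li] lin_sw[OF lt] inner_tensor lt tmap_tensor lin_facts sw_tensor)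
qed

lemma one_D: "one D = one A \<otimes> one H"
  by (simp add: D_def double_bicross_def)

lemma counit_D: "counit D (a \<otimes> h) = counit A a * counit H h"
proof -
  have "lform (\<lambda>a. counit A a * counit H h)" "lform (\<lambda>h. counit A a * counit H h)" for a h
    using A.dA(2) H.dA(2) by (auto intro!: lformI simp: lform_add lform_scl algebra_simps)
  then show ?thesis by (simp add: D_def double_bicross_def tlift_tensor[OF vs_field])
qed

lemma C_one_left: "C (one H \<otimes> a) = a \<otimes> one H"
proof -
  have "H.rho (one H) = one B \<otimes> one H" using H.A(1) by (simp add: braided_bialgebra_def)
  then show ?thesis by (simp add: C_tensor sw_tensor lin_facts A.ac_one)
qed

lemma C_one_right: "C (h \<otimes> one A) = one A \<otimes> h"
proof -
  have "A.ac b (one A) = scl (counit B b) (one A)" for b using A.A(1) by (simp add: braided_bialgebra_def)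
  then have "C (h \<otimes> one A) = sw (H.rho h) (\<lambda>b h0. one A \<otimes> scl (counit B b) h0)"
    by (simp add: C_tensor lin_scl[OF linear_tensor_left] lin_scl[OF linear_tensor_right])
  also have "\<dots> = one A \<otimes> h"
    by (simp add: lin_sw[OF linear_tensor_right, symmetric] H.rho_counit)
  finally show ?thesis .
qed

lemma mult_D_A_aux: "D.mu (a \<otimes> one H) (b \<otimes> g) =
    sw (comult A b) (\<lambda>b1 b2. A.mu a b1 \<otimes> H.mu (\<beta> (one H \<otimes> b2)) g)"
  by (simp add: mult_D H.left.\<Delta>_one sw_tensor lin_facts lin_comp[OF lin_C] C_one_left \<alpha>_one)

lemma mult_D_H_aux: "D.mu (a \<otimes> h) (one A \<otimes> g) =
    sw (comult H h) (\<lambda>h1 h2. A.mu a (\<alpha> (h1 \<otimes> one A)) \<otimes> H.mu h2 g)"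
  by (simp add: mult_D A.left.\<Delta>_one sw_tensor lin_facts lin_comp[OF lin_C] C_one_right \<beta>_one)

text \<open>
  This condition on a matched pair comes from the left unit law of \<open>D\<close>: the product
  \<open>(1 \<otimes> 1)(b \<otimes> 1) = b\<^sub>1 \<otimes> \<beta>(1 \<otimes> b\<^sub>2)\<close> equals \<open>b \<otimes> 1\<close>, and \<open>\<epsilon> \<otimes> id\<close> is applied.
\<close>

lemma \<beta>_one_left: "\<beta> (one H \<otimes> b) = scl (counit A b) (one H)"
proof -
  have "b \<otimes> one H = D.mu (one A \<otimes> one H) (b \<otimes> one H)"
    using D.left.mul_one_left[of "b \<otimes> one H"] by (simp add: one_D)
  also have "\<dots> = sw (comult A b) (\<lambda>b1 b2. b1 \<otimes> \<beta> (one H \<otimes> b2))"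
    by (simp add: mult_D_A_aux A.left.mul_one_left H.left.mul_one_right)
  finally have "kl (counit A) (b \<otimes> one H) = kl (counit A) (sw (comult A b) (\<lambda>b1 b2. b1 \<otimes> \<beta> (one H \<otimes> b2)))"
    by simp
  also have "\<dots> = sw (comult A b) (\<lambda>b1 b2. \<beta> (one H \<otimes> scl (counit A b1) b2))"
    by (simp add: lin_sw[OF lin_kl[OF lin_id]] kl_tensor A.dA(2) lin_scl[OF linear_tensor_right] lin_scl[OF lin_\<beta>])
  also have "\<dots> = \<beta> (one H \<otimes> b)"
    by (simp add: lin_sw[OF lin_comp[OF lin_\<beta> linear_tensor_right], symmetric] A.dA(4))
  finally show ?thesis by (simp add: kl_tensor A.dA(2))
qed

lemma \<alpha>_one_right: "\<alpha> (h \<otimes> one A) = scl (counit H h) (one A)"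
proof -
  have "one A \<otimes> h = D.mu (one A \<otimes> h) (one A \<otimes> one H)"
    using D.left.mul_one_right[of "one A \<otimes> h"] by (simp add: one_D)
  also have "\<dots> = sw (comult H h) (\<lambda>h1 h2. \<alpha> (h1 \<otimes> one A) \<otimes> h2)"
    by (simp add: mult_D_H_aux A.left.mul_one_left H.left.mul_one_right)
  finally have "kr (counit H) (one A \<otimes> h) = kr (counit H) (sw (comult H h) (\<lambda>h1 h2. \<alpha> (h1 \<otimes> one A) \<otimes> h2))"
    by simp
  also have "\<dots> = sw (comult H h) (\<lambda>h1 h2. \<alpha> (scl (counit H h2) h1 \<otimes> one A))"
    by (simp add: lin_sw[OF lin_kr[OF lin_id]] kr_tensor H.dA(2) lin_scl[OF linear_tensor_left] lin_scl[OF lin_\<alpha>])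
  also have "\<dots> = \<alpha> (h \<otimes> one A)"
    by (simp add: lin_sw[OF lin_comp[OF lin_\<alpha> linear_tensor_left], symmetric] H.dA(5))
  finally show ?thesis by (simp add: kr_tensor H.dA(2))
qed

lemma mult_D_A: "D.mu (a \<otimes> one H) (b \<otimes> g) = A.mu a b \<otimes> g"
proof -
  have "D.mu (a \<otimes> one H) (b \<otimes> g) = sw (comult A b) (\<lambda>b1 b2. A.mu a (scl (counit A b2) b1) \<otimes> g)"
    by (simp add: mult_D_A_aux \<beta>_one_left lin_scl[OF H.left.mul_l] lin_scl[OF A.left.mul_r] H.left.mul_one_left
        lin_scl[OF A.mA(1)] lin_scl[OF H.mA(1)] lin_scl[OF linear_tensor_left] lin_scl[OF linear_tensor_right])
  also have "\<dots> = A.mu a b \<otimes> g"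
    by (simp add: lin_sw[OF linear_tensor_left, symmetric] lin_sw[OF A.left.mul_r, symmetric] A.dA(5))
  finally show ?thesis .
qed

lemma mult_D_H: "D.mu (a \<otimes> h) (one A \<otimes> g) = a \<otimes> H.mu h g"
proof -
  have "D.mu (a \<otimes> h) (one A \<otimes> g) = sw (comult H h) (\<lambda>h1 h2. a \<otimes> H.mu (scl (counit H h1) h2) g)"
    by (simp add: mult_D_H_aux \<alpha>_one_right lin_scl[OF H.left.mul_l] lin_scl[OF A.left.mul_r] A.left.mul_one_right
        lin_scl[OF A.mA(1)] lin_scl[OF H.mA(1)] lin_scl[OF linear_tensor_left] lin_scl[OF linear_tensor_right])
  also have "\<dots> = a \<otimes> H.mu h g"
    by (simp add: lin_sw[OF linear_tensor_right, symmetric] lin_sw[OF H.left.mul_l, symmetric] H.dA(4))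
  finally show ?thesis .
qed

text \<open>
  By \<open>mult_D_A\<close> the slice maps \<open>D \<rightarrow> A\<close> commute with left multiplication by \<open>A\<close>, so they preserve left
  integrals, and uniqueness in \<open>A\<close> applies to every slice.
\<close>

lemma left_integral_D:
  assumes "left_integral D \<Lambda>" "left_integral A \<Lambda>\<^sub>A" "\<Lambda>\<^sub>A \<noteq> 0"
  shows "\<exists>u. \<Lambda> = \<Lambda>\<^sub>A \<otimes> u"
proof (rule tensor_if_slices_left[OF assms(3)])
  fix y
  define e :: "('x \<times> 'y \<Rightarrow>\<^sub>0 'k) \<Rightarrow> ('x \<Rightarrow>\<^sub>0 'k)" where "e = kr (\<lambda>q. coef q y)"
  have le: "lin e" unfolding e_def by (rule lin_kr[OF lin_id])
  have "left_integral A (e \<Lambda>)"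
    unfolding left_integral_def
  proof
    fix a
    have "A.mu a (e t) = e (D.mu (a \<otimes> one H) t)" for t
    proof (rule lin_eq_tensor[of "\<lambda>t. A.mu a (e t)"])
      show "A.mu a (e (p \<otimes> q)) = e (D.mu (a \<otimes> one H) (p \<otimes> q))" for p q
        by (simp add: mult_D_A e_def kr_tensor lform_coef lin_scl[OF A.left.mul_r])
      show "lin (\<lambda>t. A.mu a (e t))" by (rule lin_comp[OF A.left.mul_r le])
      show "lin (\<lambda>t. e (D.mu (a \<otimes> one H) t))" by (rule lin_comp[OF le D.left.mul_r])
    qed
    then show "A.mu a (e \<Lambda>) = scl (counit A a) (e \<Lambda>)"
      using assms(1) by (simp add: left_integral_def counit_D H.left.\<epsilon>_one lin_scl[OF le])
  qed
  then show "\<exists>d. kr (\<lambda>q. coef q y) \<Lambda> = scl d \<Lambda>\<^sub>A"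
    using A.left_integral_unique[OF assms(2,3)] unfolding e_def by metis
qed

lemma right_integral_D:
  assumes "right_integral D \<Lambda>" "right_integral H \<Lambda>\<^sub>H" "\<Lambda>\<^sub>H \<noteq> 0"
  shows "\<exists>v. \<Lambda> = v \<otimes> \<Lambda>\<^sub>H"
proof (rule tensor_if_slices_right[OF assms(3)])
  fix x
  define e :: "('x \<times> 'y \<Rightarrow>\<^sub>0 'k) \<Rightarrow> ('y \<Rightarrow>\<^sub>0 'k)" where "e = kl (\<lambda>p. coef p x)"
  have le: "lin e" unfolding e_def by (rule lin_kl[OF lin_id])
  have "right_integral H (e \<Lambda>)"
    unfolding right_integral_def
  proof
    fix h
    have "H.mu (e t) h = e (D.mu t (one A \<otimes> h))" for t
    proof (rule lin_eq_tensor[of "\<lambda>t. H.mu (e t) h"])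
      show "H.mu (e (p \<otimes> q)) h = e (D.mu (p \<otimes> q) (one A \<otimes> h))" for p q
        by (simp add: mult_D_H e_def kl_tensor lform_coef lin_scl[OF H.left.mul_l])
      show "lin (\<lambda>t. H.mu (e t) h)" by (rule lin_comp[OF H.left.mul_l le])
      show "lin (\<lambda>t. e (D.mu t (one A \<otimes> h)))" by (rule lin_comp[OF le D.left.mul_l])
    qed
    then show "H.mu (e \<Lambda>) h = scl (counit H h) (e \<Lambda>)"
      using assms(1) by (simp add: right_integral_def counit_D A.left.\<epsilon>_one lin_scl[OF le])
  qed
  then show "\<exists>d. kl (\<lambda>p. coef p x) \<Lambda> = scl d \<Lambda>\<^sub>H"
    using H.right_integral_unique[OF assms(2,3)] unfolding e_def by metis
qed

end

lemma tensor_eq_tensor: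
  assumes "a \<otimes> u = v \<otimes> h" "a \<otimes> u \<noteq> 0"
  shows "\<exists>x. x \<noteq> 0 \<and> a \<otimes> u = scl x (a \<otimes> h)"
proof -
  have "a \<noteq> 0" using assms(2) lin_0[OF linear_tensor_left] by auto
  then obtain i where i: "coef a i \<noteq> 0" by (metis lookup_zero poly_mapping_eqI)
  have "coef a i * coef u j = coef v i * coef h j" for j
    by (metis assms(1) lookup_tensor)
  then have "u = scl (coef v i / coef a i) h"
    using i by (intro poly_mapping_eqI) (simp add: field_simps)
  then have *: "a \<otimes> u = scl (coef v i / coef a i) (a \<otimes> h)"
    by (simp add: lin_scl[OF linear_tensor_right])
  with assms(2) have "coef v i / coef a i \<noteq> 0" by (metis kvec.scale_zero_left)
  with * show ?thesis by blast
qed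

theorem proposition2p1:
  fixes B :: "('b, 'k::field) bialg"
    and A :: "('b, 'x, 'k) braided"
    and H :: "('b, 'y, 'k) braided"
    and \<alpha> :: "('y \<times> 'x \<Rightarrow>\<^sub>0 'k) \<Rightarrow> ('x \<Rightarrow>\<^sub>0 'k)"
    and \<beta> :: "('y \<times> 'x \<Rightarrow>\<^sub>0 'k) \<Rightarrow> ('y \<Rightarrow>\<^sub>0 'k)"
    and \<phi> :: "('x \<Rightarrow>\<^sub>0 'k) \<Rightarrow> ('y \<times> 'x \<Rightarrow>\<^sub>0 'k)"
    and \<psi> :: "('y \<Rightarrow>\<^sub>0 'k) \<Rightarrow> ('y \<times> 'x \<Rightarrow>\<^sub>0 'k)"
    and D :: "('b, 'x \<times> 'y, 'k) braided"
    and \<Lambda>\<^sub>A :: "'x \<Rightarrow>\<^sub>0 'k" and \<Lambda>\<^sub>H :: "'y \<Rightarrow>\<^sub>0 'k"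
    and \<Lambda>\<^sub>D\<^sub>l \<Lambda>\<^sub>D\<^sub>r :: "'x \<times> 'y \<Rightarrow>\<^sub>0 'k"
  assumes "hopf_bij_antipode B"
    and "bicross_data B A H \<alpha> \<beta> \<phi> \<psi>"
    and "D = double_bicross B A H \<alpha> \<beta> \<phi> \<psi>"
    and "braided_hopf B A" and "braided_hopf B H" and "braided_hopf B D"
    and "fin_dim A" and "fin_dim H" and "fin_dim D"
    and "left_integral A \<Lambda>\<^sub>A" and "\<Lambda>\<^sub>A \<noteq> 0"
    and "right_integral H \<Lambda>\<^sub>H" and "\<Lambda>\<^sub>H \<noteq> 0"
    and "left_integral D \<Lambda>\<^sub>D\<^sub>l" and "\<Lambda>\<^sub>D\<^sub>l \<noteq> 0"
    and "right_integral D \<Lambda>\<^sub>D\<^sub>r" and "\<Lambda>\<^sub>D\<^sub>r \<noteq> 0"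
  shows "(\<exists>u v. \<Lambda>\<^sub>D\<^sub>l = \<Lambda>\<^sub>A \<otimes> u \<and> \<Lambda>\<^sub>D\<^sub>r = v \<otimes> \<Lambda>\<^sub>H)
    \<and> (semisimple D \<longrightarrow> semisimple A \<and> semisimple H)
    \<and> (\<Lambda>\<^sub>D\<^sub>l = \<Lambda>\<^sub>D\<^sub>r \<longrightarrow>
         (\<exists>x. x \<noteq> 0 \<and> \<Lambda>\<^sub>D\<^sub>l = scl x (\<Lambda>\<^sub>A \<otimes> \<Lambda>\<^sub>H))
         \<and> (semisimple D \<longleftrightarrow> semisimple A \<and> semisimple H))"
proof -
  obtain SB where SB: "is_bialgebra flip B" "is_antipode B SB"
    using assms(1) by (auto simp: hopf_bij_antipode_def)
  obtain SA SH SD where S: "is_antipode A SA" "is_antipode H SH" "is_antipode D SD"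
    and bi: "braided_bialgebra B A" "braided_bialgebra B H" "braided_bialgebra B D"
    using assms(4-6) by (auto simp: braided_hopf_def)
  interpret fin_double_bicross B A H D SB SA SH SD \<alpha> \<beta> \<phi> \<psi>
    by unfold_locales (fact SB S bi assms)+
  obtain u where u: "\<Lambda>\<^sub>D\<^sub>l = \<Lambda>\<^sub>A \<otimes> u" using left_integral_D assms(10,11,14) by blast
  obtain v where v: "\<Lambda>\<^sub>D\<^sub>r = v \<otimes> \<Lambda>\<^sub>H" using right_integral_D assms(12,13,16) by blast
  \<comment> \<open>The counit of an integral of \<open>D\<close> has the counit of \<open>\<Lambda>\<^sub>A\<close> or of \<open>\<Lambda>\<^sub>H\<close> as a factor.\<close>
  have ss: "semisimple A \<and> semisimple H" if D: "semisimple D"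
  proof
    obtain y where y: "left_integral D y" "counit D y \<noteq> 0" by (rule D.semisimple_imp_left[OF D])
    obtain w where "y = \<Lambda>\<^sub>A \<otimes> w" using left_integral_D[OF y(1) assms(10,11)] by blast
    then have "counit A \<Lambda>\<^sub>A \<noteq> 0" using y(2) by (auto simp: counit_D)
    then show "semisimple A" by (rule A.semisimple_if_left[OF assms(10)])
    have "counit D \<Lambda>\<^sub>D\<^sub>r \<noteq> 0" by (rule D.semisimple_imp_counit_right[OF D assms(16,17)])
    then have "counit H \<Lambda>\<^sub>H \<noteq> 0" by (auto simp: v counit_D)
    then show "semisimple H"
      using H.semisimple_if_left H.right_imp_left_integral[OF assms(12)] by blast
  qed
  have unimod: "(\<exists>x. x \<noteq> 0 \<and> \<Lambda>\<^sub>D\<^sub>l = scl x (\<Lambda>\<^sub>A \<otimes> \<Lambda>\<^sub>H))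
      \<and> (semisimple D \<longleftrightarrow> semisimple A \<and> semisimple H)" if "\<Lambda>\<^sub>D\<^sub>l = \<Lambda>\<^sub>D\<^sub>r"
  proof -
    have "\<Lambda>\<^sub>A \<otimes> u = v \<otimes> \<Lambda>\<^sub>H" "\<Lambda>\<^sub>A \<otimes> u \<noteq> 0" using assms(15) that u v by metis+
    from tensor_eq_tensor[OF this] obtain x where x: "x \<noteq> 0" "\<Lambda>\<^sub>D\<^sub>l = scl x (\<Lambda>\<^sub>A \<otimes> \<Lambda>\<^sub>H)"
      unfolding u by blast
    have "semisimple D" if AH: "semisimple A" "semisimple H"
    proof (rule D.semisimple_if_left[OF assms(14)])
      have "counit A \<Lambda>\<^sub>A \<noteq> 0" by (rule A.semisimple_imp_counit_left[OF AH(1) assms(10,11)])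
      moreover have "counit H \<Lambda>\<^sub>H \<noteq> 0" by (rule H.semisimple_imp_counit_right[OF AH(2) assms(12,13)])
      ultimately show "counit D \<Lambda>\<^sub>D\<^sub>l \<noteq> 0"
        using x(1) by (simp add: x(2) lform_scl[OF D.dA(2)] counit_D)
    qed
    with x ss show ?thesis by blast
  qed
  show ?thesis using u v ss unimod by blast
qed

end
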